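(* There is an absolute constant $c_0>0$ with the following property. Let $\kappa=\kappa(x)$ satisfy $\frac{2\log\log x}{\log x}\le\kappa\le\frac12$, and let $\mathcal A\subset\mathbb N$ satisfy \[ |\{n\le x: n+h\in\mathcal A\text{ for all }h\in\mathcal H\}| = \mathfrak S(\mathcal H)\int_2^x\frac{dt}{(\log t)^{|\mathcal H|}} + O(x^{1-\kappa}) \] uniformly over all finite sets $\mathcal H\subset[0,\log^2x]\cap\mathbb Z$ with $|\mathcal H|\le\frac{\kappa\log x}{2\log\log x}$. Then $G_{\mathcal A}(x)\ge c_0\,\frac{\kappa\log^2x}{\log\log x}$ for all sufficiently large $x$.
   Context: For a finite set $\mathcal H\subset\mathbb Z$, $\mathfrak S(\mathcal H)\defeq\prod_p\big(1-\frac{|\mathcal H\bmod p|}{p}\big)\big(1-\frac1p\big)^{-|\mathcal H|}$, where $|\mathcal H\bmod p|$ is the number of residue classes mod $p$ met by $\mathcal H$ and the product is over all primes. For $\mathcal A\subset\mathbb N$, $G_{\mathcal A}(x)\defeq\max\{b-a:[a,b]\subset[1,x],\ [a,b]\cap\mathcal A=\varnothing\}$. *)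

theory Defs
  imports "HOL-Analysis.Analysis" "HOL-Computational_Algebra.Primes"
begin

(* Product over the primes in increasing order. Vanishing factors (primes all of whose residue
   classes are met by H) make the value 0, as has_prod admits finitely many zero factors. *)
definition singular_series :: "int set \<Rightarrow> real" where
  "singular_series H =
     (\<Prod>p. if prime p
           then (1 - real (card ((\<lambda>h. h mod int p) ` H)) / real p)
                  * (1 - 1 / real p) powi (- int (card H))
           else 1)"

(* The endpoints a, b are integers, so that the maximum is attained. If A contains every positive
   integer up to x, the set is empty and the value is unspecified. *)
definition largest_gap :: "nat set \<Rightarrow> real \<Rightarrow> nat" where
  "largest_gap A x =
     Max {b - a | a b. 1 \<le> a \<and> a \<le> b \<and> real b \<le> x \<and> {a..b} \<inter> A = {}}"

definition tuple_count :: "nat set \<Rightarrow> int set \<Rightarrow> real \<Rightarrow> nat" where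
  "tuple_count A H x = card {n::nat. 1 \<le> n \<and> real n \<le> x \<and> (\<forall>h\<in>H. int n + h \<in> int ` A)}"

end

theory Submission
  imports Defs "HOL-Computational_Algebra.Squarefree" "HOL-Number_Theory.Cong" "HOL-Real_Asymp.Real_Asymp"
begin

text \<open>
Let $Y$ be about $c_0 \kappa \log^2 x / \log\log x$ and let $K \le \kappa \log x / (2 \log\log x)$ be odd.
By Bonferroni, the number of $n \le x$ with $[n, n + Y] \cap A = \emptyset$ is at least the alternating
sum over $k \le K$ of the tuple counts with $H \subseteq [0, Y]$, $|H| = k$, and the hypothesis replaces
the counts by $\mathfrak S(H) \int_2^x dt / \log^k t$.

Truncated to primes up to $z$ and divided by the power of $\Theta = \prod_{p \le z} (1 - 1/p)$, the singular
series is the probability that $H$ survives a random sieve $S$ of $[0, Y]$. With $q = 1 / (\Theta \log t) \le 1/2$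
the alternating sum therefore becomes a truncation of the expansion of $E (1 - q)^{|S|}$, which by
Jensen is at least $\exp (- 2 (Y + 1) / \log t)$. The price of the truncation is the term $k = K$, which is
at most $(C Y / \log t)^K / K!$: here Mertens' upper bound for $1/\Theta$ and a Selberg upper bound for
$|S|$ cancel each other's logarithms. For small $c_0$ the first quantity wins, and all remaining errors
save a power of $\log x$.
\<close>

section \<open>Primes and Mertens' upper bound\<close>

text \<open>The level z is pulled in two directions. Replacing the singular series by its product up
  to z costs a relative error K^2/z, to be compared with a main term that may be as small as
  exp(-K); z at least 4 exp(4 K) is enough. On the other side q \<le> 1/2 needs 1/\<Theta> small
  against log t, and 1/\<Theta> is only known to be at most 22 log z, so log z has to be a small
  multiple of log x. Since K \<le> log x / (4 log log x), the choice z = 4 exp(log x / log log x)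
  serves both. This z far exceeds Y, so a sieve bound for an interval of length Y is of no use at
  level z. But the partial products only decrease beyond Y, so the term k = K is estimated at level
  Y, by a bound free of z. The cap on K says that (log x)^K \<le> x^(\<kappa>/2). The sets H in play
  number at most about that many, so the assumed errors add up to O(x^(1 - \<kappa>/2)), which is
  below x exp(-K) by a factor of order at least log x. The Bonferroni inequality carries a weight q
  because it is used twice: with q = 1 to count n, and with q = 1/(\<Theta> log t) to evaluate the
  main term.\<close>

lemma sum_lessThan_mult_coprime:
  fixes f g :: "nat \<Rightarrow> 'a :: comm_semiring_1"
  assumes "coprime q r" "q > 0" "r > 0"
  shows "(\<Sum>m<q * r. f (m mod q) * g (m mod r)) = (\<Sum>i<q. f i) * (\<Sum>j<r. g j)"
proof -
  let ?h = "\<lambda>m. (m mod q, m mod r)"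
  have inj: "inj_on ?h {..<q * r}"
  proof (rule inj_onI)
    fix m n assume *: "m \<in> {..<q * r}" "n \<in> {..<q * r}" "?h m = ?h n"
    have "[m = n] (mod q * r)"
      using * assms by (intro coprime_cong_mult_nat) (auto simp: cong_def)
    then show "m = n" using * by (simp add: cong_def)
  qed
  have "?h ` {..<q * r} = {..<q} \<times> {..<r}"
    using assms by (intro card_subset_eq) (auto simp: card_image[OF inj])
  then have "(\<Sum>(i, j)\<in>{..<q} \<times> {..<r}. f i * g j) = (\<Sum>m<q * r. f (m mod q) * g (m mod r))"
    using sum.reindex[OF inj, of "\<lambda>(i, j). f i * g j"] by (simp add: o_def)
  then show ?thesis
    by (simp add: sum_product sum.cartesian_product)
qed

text \<open>Independence of the residues modulo distinct primes. Both the orthogonality of Ramanujan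
  sums and the product formula for survival probabilities rest on it.\<close>

lemma sum_prod_mod_primes:
  fixes f :: "nat \<Rightarrow> nat \<Rightarrow> 'a :: comm_semiring_1"
  assumes "finite B" "\<forall>p\<in>B. prime p"
  shows "(\<Sum>m<\<Prod>B. \<Prod>p\<in>B. f p (m mod p)) = (\<Prod>p\<in>B. \<Sum>r<p. f p r)"
  using assms
proof (induction B rule: finite_induct)
  case empty
  then show ?case by (simp add: lessThan_Suc)
next
  case (insert q B)
  have cop: "coprime q (\<Prod>B)"
    using insert by (intro prod_coprime_right) (metis insert_iff primes_coprime)
  have pos: "q > 0" "\<Prod>B > 0"
    using insert by (auto intro!: prod_pos simp: prime_gt_0_nat)
  have dvd: "m mod p = (m mod \<Prod>B) mod p" if "p \<in> B" for m p
    using insert that dvd_prodI[of B p "\<lambda>p. p"] by (simp add: mod_mod_cancel)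
  have "(\<Sum>m<\<Prod>(insert q B). \<Prod>p\<in>insert q B. f p (m mod p)) =
        (\<Sum>m<q * \<Prod>B. f q (m mod q) * (\<Prod>p\<in>B. f p ((m mod \<Prod>B) mod p)))"
    using insert by (intro sum.cong) (auto simp: dvd[symmetric] intro!: prod.cong)
  also have "\<dots> = (\<Sum>r<q. f q r) * (\<Sum>m<\<Prod>B. \<Prod>p\<in>B. f p (m mod p))"
    using sum_lessThan_mult_coprime[OF cop pos, of "f q" "\<lambda>m. \<Prod>p\<in>B. f p (m mod p)"] by simp
  finally show ?case using insert by simp
qed

section \<open>Squarefree products of primes and elementary prime sums\<close>

definition primes_upto :: "nat \<Rightarrow> nat set" where
  "primes_upto z = {p. prime p \<and> p \<le> z}"

lemma finite_primes_upto [simp, intro]: "finite (primes_upto z)"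
  unfolding primes_upto_def by (rule finite_subset[of _ "{..z}"]) auto

lemma primes_upto_prime: "p \<in> primes_upto z \<Longrightarrow> prime p"
  by (auto simp: primes_upto_def)

lemma primes_upto_mono: "w \<le> z \<Longrightarrow> primes_upto w \<subseteq> primes_upto z"
  by (auto simp: primes_upto_def)

text \<open>A set of primes is recovered as the set of prime divisors of its product. Hence
  squarefree integers can be handled as finite sets of primes.\<close>

lemma inj_on_prod_primes: "inj_on (\<lambda>D. \<Prod>D) {D. finite D \<and> (\<forall>p\<in>D. prime (p::nat))}"
proof (rule inj_onI)
  fix D E :: "nat set"
  assume *: "D \<in> {D. finite D \<and> (\<forall>p\<in>D. prime p)}" "E \<in> {D. finite D \<and> (\<forall>p\<in>D. prime p)}"
    and eq: "\<Prod>D = \<Prod>E"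
  have "F = {p. prime p \<and> p dvd \<Prod>F}" if "finite F" "\<forall>p\<in>F. prime p" for F :: "nat set"
    using that dvd_prodI[OF that(1), of _ "\<lambda>p. p"]
    by (auto simp: prime_dvd_prod_iff) (metis primes_dvd_imp_eq)
  from this[of D] this[of E] show "D = E" using * eq by simp
qed

lemma prod_primes_dvd:
  assumes "finite D" "\<forall>p\<in>D. prime p" "\<forall>p\<in>D. p dvd (m::nat)"
  shows "\<Prod>D dvd m"
  using assms
proof (induction D rule: finite_induct)
  case (insert q D)
  then have "coprime q (\<Prod>D)"
    by (intro prod_coprime_right) (metis insert_iff primes_coprime)
  with insert show ?case by (simp add: divides_mult)
qed simp

lemma prod_le_prod_subset:
  fixes f :: "'a \<Rightarrow> real"
  assumes "finite B" "A \<subseteq> B" "\<And>b. b \<in> B \<Longrightarrow> 0 \<le> f b" "\<And>b. b \<in> B - A \<Longrightarrow> f b \<le> 1"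
  shows "prod f B \<le> prod f A"
proof -
  have "prod f B = prod f (B - A) * prod f A"
    using assms by (intro prod.subset_diff)
  also have "\<dots> \<le> 1 * prod f A"
    using assms by (intro mult_right_mono prod_le_1 prod_nonneg) auto
  finally show ?thesis by simp
qed

lemma sum_ln_prime_dvd_le:
  assumes "m > 0" "finite B" "\<forall>p\<in>B. prime p"
  shows "(\<Sum>p\<in>{p\<in>B. p dvd m}. ln (real p)) \<le> ln (real m)"
proof -
  let ?D = "{p\<in>B. p dvd m}"
  have "\<Prod>?D dvd m"
    using assms by (intro prod_primes_dvd) auto
  then have "\<Prod>?D \<le> m" using assms(1) by (rule dvd_imp_le)
  moreover have pos: "p > 0" if "p \<in> ?D" for p using assms that by (auto simp: prime_gt_0_nat)
  ultimately have "ln (\<Prod>p\<in>?D. real p) \<le> ln (real m)"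
    using assms by (subst ln_le_cancel_iff) (auto simp flip: of_nat_prod intro!: prod_pos)
  then show ?thesis
    using assms pos by (subst (asm) ln_prod) auto
qed

lemma card_multiples: "q > 0 \<Longrightarrow> card {m\<in>{1..n}. q dvd m} = n div (q::nat)"
proof -
  assume q: "q > 0"
  have "{m\<in>{1..n}. q dvd m} = (\<lambda>j. q * j) ` {1..n div q}"
  proof (intro equalityI subsetI)
    fix m assume "m \<in> {m\<in>{1..n}. q dvd m}"
    moreover from this obtain j where "m = q * j" by (auto elim: dvdE)
    ultimately show "m \<in> (\<lambda>j. q * j) ` {1..n div q}"
      using q by (auto simp: less_eq_div_iff_mult_less_eq mult.commute Suc_le_eq)
  next
    fix m assume "m \<in> (\<lambda>j. q * j) ` {1..n div q}"
    then show "m \<in> {m\<in>{1..n}. q dvd m}"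
      using q by (auto simp: less_eq_div_iff_mult_less_eq mult.commute Suc_le_eq)
  qed
  also have "card \<dots> = n div q"
    using q by (subst card_image) (auto simp: inj_on_def)
  finally show ?thesis .
qed

text \<open>Legendre's formula for $n!$, keeping only the first power of each prime.\<close>
lemma sum_ln_over_primes_le:
  assumes "n \<ge> 1"
  shows "(\<Sum>p\<in>primes_upto n. ln (real p) / real p) \<le> 2 * ln (real n)"
proof -
  have "(\<Sum>p\<in>primes_upto n. real n * (ln (real p) / real p)) \<le>
        (\<Sum>p\<in>primes_upto n. 2 * (real (n div p) * ln (real p)))"
  proof (rule sum_mono)
    fix p assume p: "p \<in> primes_upto n"
    then have p1: "p \<ge> 1" "p \<le> n" by (auto simp: primes_upto_def Suc_le_eq prime_gt_0_nat)
    then have "n div p \<ge> 1" by (simp add: div_greater_zero_iff Suc_le_eq)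
    \<comment> \<open>As n div p is at least 1, the floor loses at most half of n / p. This is the
      source of the factor 2.\<close>
    have "n \<le> p * 1 + p * (n div p)"
      using dividend_less_times_div[of p n] p1 by simp
    also have "\<dots> \<le> p * (n div p) + p * (n div p)"
      using \<open>n div p \<ge> 1\<close> by (intro add_right_mono mult_left_mono) auto
    finally have "n \<le> 2 * (n div p) * p" by (simp only: mult_2 add_mult_distrib mult.commute[of p])
    then have "real n \<le> 2 * real (n div p) * real p"
      by (metis of_nat_le_iff of_nat_mult of_nat_numeral)
    then have "real n / real p \<le> 2 * real (n div p)" using p1 by (simp add: divide_simps)
    then have "real n / real p * ln (real p) \<le> 2 * real (n div p) * ln (real p)"
      using p1 by (intro mult_right_mono) auto
    then show "real n * (ln (real p) / real p) \<le> 2 * (real (n div p) * ln (real p))"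
      by (simp add: mult_ac)
  qed
  also have "\<dots> = 2 * (\<Sum>p\<in>primes_upto n. \<Sum>m\<in>{m\<in>{1..n}. p dvd m}. ln (real p))"
    unfolding sum_distrib_left
    by (intro sum.cong refl) (simp only: sum_constant card_multiples primes_upto_prime prime_gt_0_nat)
  also have "(\<Sum>p\<in>primes_upto n. \<Sum>m\<in>{m\<in>{1..n}. p dvd m}. ln (real p)) =
             (\<Sum>m\<in>{1..n}. \<Sum>p\<in>{p\<in>primes_upto n. p dvd m}. ln (real p))"
    by (rule sum.swap_restrict) auto
  also have "\<dots> \<le> (\<Sum>m\<in>{1..n}. ln (real n))"
  proof (rule sum_mono)
    fix m assume m: "m \<in> {1..n}"
    then have "(\<Sum>p\<in>{p\<in>primes_upto n. p dvd m}. ln (real p)) \<le> ln (real m)"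
      by (intro sum_ln_prime_dvd_le) (auto simp: primes_upto_prime)
    also have "\<dots> \<le> ln (real n)" using m by auto
    finally show "(\<Sum>p\<in>{p\<in>primes_upto n. p dvd m}. ln (real p)) \<le> ln (real n)" .
  qed
  finally have "real n * (\<Sum>p\<in>primes_upto n. ln (real p) / real p) \<le> real n * (2 * ln (real n))"
    by (simp add: sum_distrib_left mult_ac)
  then show ?thesis using assms by (subst (asm) mult_le_cancel_left_pos) auto
qed

lemma harm_le_1_plus_ln: "n \<ge> 1 \<Longrightarrow> harm n \<le> 1 + ln (real n)"
  using decseqD[OF decseq_harm_diff_ln, of 0 "n - 1"] by (simp add: harm_expand(2))

text \<open>Weight each squarefree $d | P(z)$ by $1/d$. The mean of $\log d$ is at most $2 \log z$, so by Markov
  at least half of the total weight comes from $d \le z^4$.\<close>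
lemma prod_one_plus_recip_primes_le:
  assumes "z \<ge> 1"
  shows "(\<Prod>p\<in>primes_upto z. 1 + 1 / real p) \<le> 2 + 8 * ln (real z)"
proof -
  let ?P = "primes_upto z" and ?w = "\<lambda>D. 1 / real (\<Prod>D)"
  define W where "W = (\<Sum>D\<in>Pow ?P. ?w D)"
  have W: "(\<Prod>p\<in>?P. 1 + 1 / real p) = W"
    unfolding W_def using prod_add[of ?P "\<lambda>p. 1 / real p" "\<lambda>_. 1"]
    by (simp add: add.commute prod_dividef)
  have prodpos: "\<Prod>D > 0" if "D \<subseteq> ?P" for D
    using that by (intro prod_pos) (auto simp: primes_upto_def prime_gt_0_nat)
  have "(\<Sum>D\<in>Pow ?P. ?w D * ln (real (\<Prod>D))) = (\<Sum>D\<in>Pow ?P. \<Sum>p\<in>{p\<in>?P. p \<in> D}. ?w D * ln (real p))"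
  proof (rule sum.cong)
    fix D assume "D \<in> Pow ?P"
    then have D: "D \<subseteq> ?P" by auto
    then have pos: "real p > 0" if "p \<in> D" for p using that by (auto simp: primes_upto_def prime_gt_0_nat)
    have "{p\<in>?P. p \<in> D} = D" using D by auto
    moreover have "ln (real (\<Prod>D)) = (\<Sum>p\<in>D. ln (real p))"
      using D pos by (simp add: ln_prod finite_subset)
    ultimately show "?w D * ln (real (\<Prod>D)) = (\<Sum>p\<in>{p\<in>?P. p \<in> D}. ?w D * ln (real p))"
      by (simp add: sum_distrib_left)
  qed auto
  also have "\<dots> = (\<Sum>p\<in>?P. \<Sum>D\<in>{D\<in>Pow ?P. p \<in> D}. ?w D * ln (real p))"
    by (intro sum.swap_restrict) auto
  also have "\<dots> \<le> (\<Sum>p\<in>?P. ln (real p) / real p * W)"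
  proof (rule sum_mono)
    fix p assume p: "p \<in> ?P"
    then have p1: "p \<ge> 1" by (auto simp: primes_upto_def Suc_le_eq prime_gt_0_nat)
    \<comment> \<open>Deleting p matches the D containing p with those avoiding it and takes a
      factor 1/p out of the weight: p divides a random d with probability at most 1/p.\<close>
    have "(\<Sum>D\<in>{D\<in>Pow ?P. p \<in> D}. ?w D) = (\<Sum>D\<in>Pow (?P - {p}). ?w D / real p)"
    proof (rule sum.reindex_bij_witness[of _ "insert p" "\<lambda>D. D - {p}"])
      fix D assume D: "D \<in> {D\<in>Pow ?P. p \<in> D}"
      then have "finite D" by (auto intro: finite_subset)
      then show "?w (D - {p}) / real p = ?w D" using D
        by (simp add: prod.remove[of D p])
    qed (use p in auto)
    also have "\<dots> \<le> (\<Sum>D\<in>Pow ?P. ?w D / real p)"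
      by (intro sum_mono2) (auto simp del: of_nat_prod)
    also have "\<dots> = W / real p" by (simp add: W_def sum_divide_distrib)
    finally have "ln (real p) * (\<Sum>D\<in>{D\<in>Pow ?P. p \<in> D}. ?w D) \<le> ln (real p) * (W / real p)"
      using p1 by (intro mult_left_mono) auto
    then show "(\<Sum>D\<in>{D\<in>Pow ?P. p \<in> D}. ?w D * ln (real p)) \<le> ln (real p) / real p * W"
      by (simp add: sum_distrib_left mult_ac)
  qed
  also have "\<dots> = (\<Sum>p\<in>?P. ln (real p) / real p) * W" by (simp add: sum_distrib_right)
  also have "\<dots> \<le> 2 * ln (real z) * W"
    using sum_ln_over_primes_le[OF assms] by (intro mult_right_mono) (auto simp: W_def intro!: sum_nonneg simp del: of_nat_prod)
  finally have mean: "(\<Sum>D\<in>Pow ?P. ?w D * ln (real (\<Prod>D))) \<le> 2 * ln (real z) * W" .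
  define G where "G = {D\<in>Pow ?P. \<Prod>D \<le> z ^ 4}"
  have fin: "finite G" by (auto simp: G_def)
  have "(\<Sum>D\<in>G. ?w D) = (\<Sum>d\<in>(\<lambda>D. \<Prod>D) ` G. 1 / real d)"
    by (subst sum.reindex)
       (auto intro!: inj_on_subset[OF inj_on_prod_primes] simp: G_def primes_upto_prime finite_subset[of _ ?P])
  also have "\<dots> \<le> (\<Sum>d\<in>{1..z ^ 4}. 1 / real d)"
    using prodpos by (intro sum_mono2) (auto simp: G_def Suc_le_eq)
  also have "\<dots> = harm (z ^ 4)" by (simp add: harm_def divide_inverse)
  also have "\<dots> \<le> 1 + 4 * ln (real z)"
    using harm_le_1_plus_ln[of "z ^ 4"] assms by (simp add: ln_realpow)
  finally have Gle: "(\<Sum>D\<in>G. ?w D) \<le> 1 + 4 * ln (real z)" .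
  show ?thesis
  proof (cases "z = 1")
    case True
    then have "?P = {}" by (auto simp: primes_upto_def dest: prime_gt_1_nat)
    then show ?thesis using True by simp
  next
    case False
    then have lnz: "ln (real z) > 0" using assms by simp
    have "4 * ln (real z) * (\<Sum>D\<in>Pow ?P - G. ?w D) \<le> (\<Sum>D\<in>Pow ?P - G. ?w D * ln (real (\<Prod>D)))"
      unfolding sum_distrib_left
    proof (rule sum_mono)
      fix D assume D: "D \<in> Pow ?P - G"
      then have "\<Prod>D > z ^ 4" by (auto simp: G_def)
      then have "real z ^ 4 < real (\<Prod>D)" by (metis of_nat_less_iff of_nat_power)
      then have "ln (real z ^ 4) \<le> ln (real (\<Prod>D))" using assms prodpos[of D] D
        by (intro ln_mono) (auto intro!: prod_nonneg)
      then have "4 * ln (real z) \<le> ln (real (\<Prod>D))" using assms by (simp add: ln_realpow)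
      then have "4 * ln (real z) * ?w D \<le> ln (real (\<Prod>D)) * ?w D"
        by (rule mult_right_mono) (auto intro!: prod_nonneg)
      then show "4 * ln (real z) * ?w D \<le> ?w D * ln (real (\<Prod>D))" by (simp add: mult_ac)
    qed
    also have "\<dots> \<le> (\<Sum>D\<in>Pow ?P. ?w D * ln (real (\<Prod>D)))"
      using prodpos by (intro sum_mono2) (auto intro!: mult_nonneg_nonneg ln_ge_zero simp del: of_nat_prod simp: Suc_le_eq)
    also have "\<dots> \<le> 2 * ln (real z) * W" by (rule mean)
    finally have "(\<Sum>D\<in>Pow ?P - G. ?w D) \<le> W / 2" using lnz by (simp add: field_simps)
    moreover have "W = (\<Sum>D\<in>Pow ?P - G. ?w D) + (\<Sum>D\<in>G. ?w D)"
      unfolding W_def by (intro sum.subset_diff) (auto simp: G_def)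
    ultimately have "W \<le> 2 * (\<Sum>D\<in>G. ?w D)" by linarith
    then show ?thesis using Gle W by linarith
  qed
qed

definition sieve_density :: "nat \<Rightarrow> real" where
  "sieve_density z = (\<Prod>p\<in>primes_upto z. 1 - 1 / real p)"

lemma sieve_density_pos: "sieve_density z > 0"
  unfolding sieve_density_def by (intro prod_pos) (auto simp: primes_upto_def dest: prime_gt_1_nat)

text \<open>Multiplying by the product of 1 + 1/p gives the product of 1 - 1/p^2, which is at least
  the same product over all integers from 2 on; that one telescopes and stays above 1/2. The
  constant is 22 = 16 + 6, where ln 2 \<ge> 2/3 absorbs the additive 4 into 6 ln z.\<close>

lemma sieve_density_inverse_le:
  assumes "z \<ge> 2"
  shows "1 / sieve_density z \<le> 22 * ln (real z)"
proof -
  have tele: "(\<Prod>n\<in>{2..z}. 1 - 1 / real n ^ 2) = (real z + 1) / (2 * real z)" using assms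
  proof (induction z rule: dec_induct)
    case base
    show ?case by simp
  next
    case (step n)
    have "(\<Prod>n\<in>{2..Suc n}. 1 - 1 / real n ^ 2) = (real n + 1) / (2 * real n) * (1 - 1 / (real n + 1) ^ 2)"
      using step by (simp add: prod.cl_ivl_Suc add.commute)
    also have "\<dots> = (real (Suc n) + 1) / (2 * real (Suc n))"
      using step by (simp add: divide_simps) (simp add: power2_eq_square algebra_simps)
    finally show ?case .
  qed
  have "1 / 2 \<le> (real z + 1) / (2 * real z)" using assms by (simp add: field_simps)
  also have "\<dots> = (\<Prod>n\<in>{2..z}. 1 - 1 / real n ^ 2)" by (rule tele[symmetric])
  also have "\<dots> \<le> (\<Prod>p\<in>primes_upto z. 1 - 1 / real p ^ 2)"
    by (rule prod_le_prod_subset) (auto simp: primes_upto_def prime_ge_2_nat power_le_one)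
  also have "\<dots> = (\<Prod>p\<in>primes_upto z. 1 + 1 / real p) * sieve_density z"
    unfolding sieve_density_def prod.distrib[symmetric]
    by (intro prod.cong) (auto simp: power2_eq_square algebra_simps)
  finally have "1 / 2 \<le> (\<Prod>p\<in>primes_upto z. 1 + 1 / real p) * sieve_density z" .
  then have "1 / sieve_density z \<le> 2 * (\<Prod>p\<in>primes_upto z. 1 + 1 / real p)"
    using sieve_density_pos[of z] by (simp add: field_simps)
  also have "\<dots> \<le> 2 * (2 + 8 * ln (real z))"
    using prod_one_plus_recip_primes_le[of z] assms by simp
  also have "\<dots> \<le> 22 * ln (real z)"
  proof -
    have "2 / 3 \<le> ln (2::real)" by (rule ln2_ge_two_thirds)
    also have "\<dots> \<le> ln (real z)" using assms by simp
    finally show ?thesis by simp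
  qed
  finally show ?thesis .
qed

section \<open>Selberg's sieve for intervals\<close>

lemma sum_periodic_interval:
  fixes g :: "nat \<Rightarrow> real"
  assumes per: "\<And>m. g (m mod Q) = g m" and Q: "Q > 0"
  shows "(\<Sum>m\<in>{M..<M + Q}. g m) = (\<Sum>r<Q. g r)"
proof (induction M)
  case (Suc M)
  have "(\<Sum>m\<in>{M..<M + Q}. g m) + g (M + Q) = (\<Sum>m\<in>{M..<Suc (M + Q)}. g m)"
    by simp
  also have "\<dots> = g M + (\<Sum>m\<in>{Suc M..<Suc M + Q}. g m)"
    by (subst sum.atLeast_Suc_lessThan) auto
  finally show ?case
    using Suc per[of "M + Q"] per[of M] by simp
qed (simp add: lessThan_atLeast0)

text \<open>Complete periods contribute exactly; what remains has fewer than \<open>Q\<close> terms,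
  each at most \<open>B\<close>.\<close>

lemma abs_sum_periodic_diff_le:
  fixes g :: "nat \<Rightarrow> real"
  assumes per: "\<And>m. g (m mod Q) = g m" and Q: "Q > 0" and B: "\<And>m. \<bar>g m\<bar> \<le> B"
  shows "\<bar>(\<Sum>m\<in>{M..<M + N}. g m) - real (N div Q) * (\<Sum>r<Q. g r)\<bar> \<le> real Q * B"
proof (induction N arbitrary: M rule: less_induct)
  case (less N)
  show ?case
  proof (cases "N < Q")
    case True
    have "\<bar>\<Sum>m\<in>{M..<M + N}. g m\<bar> \<le> (\<Sum>m\<in>{M..<M + N}. B)"
      by (rule order_trans[OF sum_abs sum_mono]) (rule B)
    also have "\<dots> \<le> real Q * B"
      using True B[of 0] by (auto intro!: mult_right_mono)
    finally show ?thesis using True by simp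
  next
    case False
    have "(\<Sum>m\<in>{M..<M + N}. g m) = (\<Sum>m\<in>{M..<M + Q}. g m) + (\<Sum>m\<in>{M + Q..<M + Q + (N - Q)}. g m)"
      using False by (subst sum.atLeastLessThan_concat) auto
    moreover have "N div Q = Suc ((N - Q) div Q)"
      using False Q by (simp add: le_div_geq)
    ultimately show ?thesis
      using less.IH[of "N - Q" "M + Q"] False Q sum_periodic_interval[of g Q M, OF per Q]
      by (simp add: algebra_simps)
  qed
qed

text \<open>The Ramanujan sum $c_d(m)$ for $d$ the product of the primes in \<^term>\<open>D\<close>.\<close>
definition ramanujan :: "nat set \<Rightarrow> nat \<Rightarrow> real" where
  "ramanujan D m = (\<Prod>p\<in>D. if p dvd m then real p - 1 else - 1)"

definition phi :: "nat set \<Rightarrow> real" where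
  "phi D = (\<Prod>p\<in>D. real p - 1)"

lemma abs_ramanujan_le:
  assumes "\<forall>p\<in>D. prime p"
  shows "\<bar>ramanujan D m\<bar> \<le> real (\<Prod>D)"
  unfolding ramanujan_def abs_prod of_nat_prod
  by (intro prod_mono) (use assms in \<open>auto dest!: bspec prime_ge_2_nat\<close>)

lemma phi_ge_1:
  assumes "\<forall>p\<in>D. prime p"
  shows "phi D \<ge> 1"
  unfolding phi_def by (intro prod_ge_1) (use assms in \<open>auto dest!: bspec prime_ge_2_nat\<close>)

lemma sum_lessThan_dvd_weight:
  fixes a b :: real
  assumes "p > 0"
  shows "(\<Sum>r<p. if p dvd r then a else b) = a + (real p - 1) * b"
proof -
  have "{..<p} = insert 0 {1..<p}" using assms by auto
  moreover have "(\<Sum>r\<in>{1..<p}. if p dvd r then a else b) = (\<Sum>r\<in>{1..<p}. b)"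
    by (intro sum.cong) (auto dest: nat_dvd_not_less)
  ultimately show ?thesis using assms by (simp add: of_nat_diff)
qed

text \<open>Padding both products with factors 1 brings them over the common set
  \<open>D \<union> E\<close>, the form in which residues modulo distinct primes can be summed
  independently.\<close>

lemma ramanujan_mult_conv:
  assumes "finite D" "finite E"
  shows "ramanujan D m * ramanujan E m =
    (\<Prod>p\<in>D \<union> E. (if p dvd m then (if p \<in> D then real p - 1 else 1) * (if p \<in> E then real p - 1 else 1)
                else (if p \<in> D then - 1 else 1) * (if p \<in> E then - 1 else 1)))"
proof -
  have "ramanujan D m = (\<Prod>p\<in>D \<union> E. if p \<in> D then (if p dvd m then real p - 1 else - 1) else 1)"
       "ramanujan E m = (\<Prod>p\<in>D \<union> E. if p \<in> E then (if p dvd m then real p - 1 else - 1) else 1)"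
    using assms unfolding ramanujan_def
    by (auto simp: prod.If_cases Int_absorb1 Int_absorb2 intro!: prod.cong)
  then show ?thesis by (auto simp: prod.distrib[symmetric] intro!: prod.cong)
qed

text \<open>Over a period, a prime in only one of the two sets contributes (p - 1) - (p - 1) = 0,
  and a prime in both contributes (p - 1)^2 + (p - 1) = p (p - 1).\<close>

lemma ramanujan_orthogonal:
  assumes D: "finite D" "\<forall>p\<in>D. prime p" and E: "finite E" "\<forall>p\<in>E. prime p"
  shows "(\<Sum>m<\<Prod>(D \<union> E). ramanujan D m * ramanujan E m) = (if D = E then real (\<Prod>D) * phi D else 0)"
proof -
  let ?f = "\<lambda>p r. (if p dvd r then (if p \<in> D then real p - 1 else 1) * (if p \<in> E then real p - 1 else 1)
                else (if p \<in> D then - 1 else 1) * (if p \<in> E then - 1 else 1))"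
  have "(\<Sum>m<\<Prod>(D \<union> E). ramanujan D m * ramanujan E m) = (\<Sum>m<\<Prod>(D \<union> E). \<Prod>p\<in>D \<union> E. ?f p (m mod p))"
    unfolding ramanujan_mult_conv[OF D(1) E(1)] by (simp add: dvd_mod_iff)
  also have "\<dots> = (\<Prod>p\<in>D \<union> E. \<Sum>r<p. ?f p r)"
    by (rule sum_prod_mod_primes) (use D E in auto)
  also have "\<dots> = (\<Prod>p\<in>D \<union> E. if p \<in> D \<and> p \<in> E then real p * (real p - 1) else 0)"
  proof (intro prod.cong refl)
    fix p assume "p \<in> D \<union> E"
    then have "p > 0" using D E by (auto simp: prime_gt_0_nat)
    with \<open>p \<in> D \<union> E\<close> show "(\<Sum>r<p. ?f p r) = (if p \<in> D \<and> p \<in> E then real p * (real p - 1) else 0)"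
      by (subst sum_lessThan_dvd_weight) (auto simp: algebra_simps)
  qed
  also have "\<dots> = (if D = E then real (\<Prod>D) * phi D else 0)"
    using D E by (auto simp: phi_def prod.distrib)
  finally show ?thesis .
qed

lemma ramanujan_mod: "\<forall>p\<in>D. p dvd Q \<Longrightarrow> ramanujan D (m mod Q) = ramanujan D m"
  unfolding ramanujan_def by (intro prod.cong) (auto simp: dvd_mod_iff)

text \<open>The squarefree numbers up to R, each represented by its set of prime factors.\<close>
definition small_divisors :: "nat \<Rightarrow> nat set set" where
  "small_divisors R = {D. D \<subseteq> primes_upto R \<and> \<Prod>D \<le> R}"

lemma finite_small_divisors [simp, intro]: "finite (small_divisors R)"
  unfolding small_divisors_def by (rule finite_subset[of _ "Pow (primes_upto R)"]) auto

lemma small_divisorsD: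
  assumes "D \<in> small_divisors R"
  shows "finite D" "\<forall>p\<in>D. prime p" "\<Prod>D \<le> R"
  using assms finite_subset[of D "primes_upto R"] by (auto simp: small_divisors_def primes_upto_def)

lemma inj_on_prod_small_divisors: "inj_on (\<lambda>D. \<Prod>D) (small_divisors R)"
  by (rule inj_on_subset[OF inj_on_prod_primes]) (use small_divisorsD in blast)

lemma card_small_divisors_le: "card (small_divisors R) \<le> R"
proof -
  have "(\<lambda>D. \<Prod>D) ` small_divisors R \<subseteq> {1..R}"
    using small_divisorsD by (fastforce intro!: prod_pos simp: Suc_le_eq prime_gt_0_nat)
  then have "card ((\<lambda>D. \<Prod>D) ` small_divisors R) \<le> card {1..R}" by (intro card_mono) auto
  then show ?thesis by (simp add: card_image[OF inj_on_prod_small_divisors])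
qed

lemma prime_factors_squarefree_prod:
  assumes "squarefree (n::nat)"
  shows "\<Prod>(prime_factors n) = n"
proof -
  have n: "n \<noteq> 0" using assms by (metis not_squarefree_0)
  have "(\<Prod>p\<in>prime_factors n. p ^ multiplicity p n) = n"
    using n prod_prime_factors[of n] by simp
  moreover have "p ^ multiplicity p n = p" if "p \<in> prime_factors n" for p
    using assms that n by (auto simp: squarefree_factorial_semiring')
  ultimately show ?thesis by simp
qed

lemma recip_square_le: "n \<ge> 1 \<Longrightarrow> 1 / real (Suc n) ^ 2 \<le> 1 / real n - 1 / real (Suc n)"
proof -
  assume n: "n \<ge> 1"
  have "1 / real (Suc n) ^ 2 \<le> 1 / (real n * real (Suc n))"
    using n unfolding power2_eq_square by (intro divide_left_mono mult_right_mono) auto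
  also have "\<dots> = 1 / real n - 1 / real (Suc n)"
    using n by (simp add: field_simps)
  finally show ?thesis .
qed

lemma sum_recip_squares_le: "(\<Sum>m\<in>{1..R}. 1 / real m ^ 2) \<le> 2"
proof -
  have "(\<Sum>m\<in>{1..R}. 1 / real m ^ 2) \<le> 2 - 1 / real R" if "R \<ge> 1" using that
  proof (induction R rule: dec_induct)
    case (step n)
    have "1 / real (Suc n) ^ 2 \<le> 1 / real n - 1 / real (Suc n)"
      using step by (intro recip_square_le) auto
    then show ?case using step by simp
  qed simp
  then show ?thesis by (cases "R \<ge> 1") (auto intro: order_trans)
qed

text \<open>Each n up to R is uniquely a squarefree number times a square. So the harmonic sum is at
  most the squarefree sum times the sum of 1/m^2, and the latter is at most 2.\<close>

lemma harm_le_small_divisors: "harm R \<le> 2 * (\<Sum>D\<in>small_divisors R. 1 / real (\<Prod>D))"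
proof -
  let ?h = "\<lambda>n. (prime_factors (squarefree_part n), square_part n)"
  let ?w = "\<lambda>(D, m). 1 / real (\<Prod>D) * (1 / real m ^ 2)"
  have dec: "n = \<Prod>(prime_factors (squarefree_part n)) * square_part n ^ 2" for n :: nat
    by (subst prime_factors_squarefree_prod) (auto simp: squarefree_decompose[symmetric])
  have inj: "inj_on ?h {1..R}"
    by (rule inj_onI) (metis dec prod.inject)
  have sub: "?h ` {1..R} \<subseteq> small_divisors R \<times> {1..R}"
  proof
    fix x assume "x \<in> ?h ` {1..R}"
    then obtain n where n: "n \<in> {1..R}" and x: "x = ?h n" by auto
    have pos: "square_part n > 0" "squarefree_part n > 0" using n by (auto intro: Nat.gr0I)
    have "squarefree_part n dvd n" "square_part n dvd n"
      using squarefree_decompose[of n] by (metis dvd_triv_left, metis dvd_mult dvd_power zero_less_numeral)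
    then have le: "squarefree_part n \<le> R" "square_part n \<le> R"
      using n by (auto dest!: dvd_imp_le)
    have "p \<le> squarefree_part n" if "p \<in> prime_factors (squarefree_part n)" for p
      using that pos by (auto intro: dvd_imp_le)
    then show "x \<in> small_divisors R \<times> {1..R}"
      using pos le unfolding x small_divisors_def primes_upto_def
      by (auto simp: prime_factors_squarefree_prod intro: order_trans)
  qed
  have "harm R = (\<Sum>n\<in>{1..R}. 1 / real n)" by (simp add: harm_def divide_inverse)
  also have "\<dots> = (\<Sum>n\<in>{1..R}. ?w (?h n))"
  proof (intro sum.cong refl)
    fix n
    show "1 / real n = ?w (?h n)"
      by (subst dec[of n]) (simp only: case_prod_conv of_nat_mult of_nat_power times_divide_times_eq mult_1)
  qed
  also have "\<dots> = (\<Sum>x\<in>?h ` {1..R}. ?w x)" by (subst sum.reindex[OF inj]) (simp only: o_def)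
  also have "\<dots> \<le> (\<Sum>x\<in>small_divisors R \<times> {1..R}. ?w x)"
    by (intro sum_mono2 sub) (auto intro!: mult_nonneg_nonneg prod_nonneg)
  also have "\<dots> = (\<Sum>D\<in>small_divisors R. 1 / real (\<Prod>D)) * (\<Sum>m\<in>{1..R}. 1 / real m ^ 2)"
    by (simp add: sum_product sum.cartesian_product)
  also have "\<dots> \<le> (\<Sum>D\<in>small_divisors R. 1 / real (\<Prod>D)) * 2"
    by (intro mult_left_mono sum_recip_squares_le sum_nonneg) (auto intro!: prod_nonneg)
  finally show ?thesis by (simp add: mult.commute)
qed

text \<open>Selberg's sieve in dual form: with \<^term>\<open>F\<close> the combination of Ramanujan sums below, every
  sifted \<^term>\<open>m\<close> has $F(m) = G$, whereas orthogonality makes the mean square of \<^term>\<open>F\<close> over long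
  intervals equal to $G$. The error $R^6$ is wasteful but harmless, as $R$ will be $N^{1/12}$.\<close>
lemma selberg_sieve:
  assumes "R \<ge> 1" and G_def: "G = (\<Sum>D\<in>small_divisors R. 1 / phi D)"
  shows "real (card {m\<in>{M..<M + N}. \<forall>p\<in>primes_upto R. \<not> p dvd m}) \<le> real N / G + real R ^ 6"
proof -
  let ?S = "{m\<in>{M..<M + N}. \<forall>p\<in>primes_upto R. \<not> p dvd m}"
  let ?D = "small_divisors R"
  \<comment> \<open>On sifted m every prime of \<open>D\<close> gives the factor -1 in the Ramanujan
    sum. The sign here cancels these, so that each term equals 1 / \<open>phi D\<close>.\<close>
  define v where "v = (\<lambda>D. (- 1) ^ card D / phi D)"
  define F where "F = (\<lambda>m. \<Sum>D\<in>?D. v D * ramanujan D m)"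
  have tot1: "phi D \<ge> 1" if "D \<in> ?D" for D using phi_ge_1 small_divisorsD[OF that] by blast
  have "{} \<in> ?D" using assms by (simp add: small_divisors_def)
  then have "1 / phi {} \<le> G" unfolding G_def
    using tot1 by (intro member_le_sum) (auto intro: order_trans[OF zero_le_one])
  then have G1: "G \<ge> 1" by (simp add: phi_def)
  have FS: "F m = G" if "m \<in> ?S" for m
    unfolding F_def G_def
  proof (intro sum.cong refl)
    fix D assume D: "D \<in> ?D"
    have "ramanujan D m = (\<Prod>p\<in>D. - 1)" unfolding ramanujan_def
      using that D by (intro prod.cong) (auto simp: small_divisors_def)
    then show "v D * ramanujan D m = 1 / phi D" by (simp add: v_def power_mult_distrib[symmetric])
  qed
  \<comment> \<open>Only the diagonal survives over full periods. The incomplete period costs at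
    most the modulus, at most R^2, times the bound R^2 on the product; over at most R^2 pairs this
    makes R^6.\<close>
  have pair: "(\<Sum>m\<in>{M..<M + N}. ramanujan D m * ramanujan E m) * (v D * v E) \<le>
      (if D = E then real N / phi D else 0) + real R ^ 4"
    if D: "D \<in> ?D" and E: "E \<in> ?D" for D E
  proof -
    note D' = small_divisorsD[OF D] and E' = small_divisorsD[OF E]
    let ?Q = "\<Prod>(D \<union> E)" and ?T = "\<Sum>m\<in>{M..<M + N}. ramanujan D m * ramanujan E m"
    let ?P = "\<Sum>m<\<Prod>(D \<union> E). ramanujan D m * ramanujan E m"
    have Qpos: "?Q > 0" using D' E' by (intro prod_pos) (auto simp: prime_gt_0_nat)
    have "?Q dvd \<Prod>D * \<Prod>E" 
      by (simp only: prod.union_inter[OF D'(1) E'(1), of "\<lambda>p. p", symmetric] dvd_triv_left)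
    moreover have "\<Prod>D * \<Prod>E > 0"
      using D' E' by (auto intro!: prod_pos simp: prime_gt_0_nat)
    ultimately have "?Q \<le> \<Prod>D * \<Prod>E" by (intro dvd_imp_le)
    also have "\<dots> \<le> R * R" using D' E' by (intro mult_mono) auto
    finally have QR: "real ?Q \<le> real R ^ 2" by (metis of_nat_le_iff of_nat_mult power2_eq_square)
    have bound: "\<bar>ramanujan D m * ramanujan E m\<bar> \<le> real R ^ 2" for m
      unfolding abs_mult power2_eq_square
      using abs_ramanujan_le[OF D'(2), of m] abs_ramanujan_le[OF E'(2), of m] D'(3) E'(3)
      by (intro mult_mono) (auto simp del: of_nat_prod intro: order_trans)
    have "\<bar>?T - real (N div ?Q) * ?P\<bar> \<le> real ?Q * real R ^ 2"
    proof (rule abs_sum_periodic_diff_le[OF _ Qpos bound])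
      have "\<forall>p\<in>D \<union> E. p dvd ?Q"
        using D' E' dvd_prodI[of "D \<union> E" _ "\<lambda>p. p"] by blast
      then show "ramanujan D (m mod ?Q) * ramanujan E (m mod ?Q) = ramanujan D m * ramanujan E m" for m
        by (simp add: ramanujan_mod)
    qed
    also have "\<dots> \<le> real R ^ 2 * real R ^ 2" using QR by (intro mult_right_mono) auto
    also have "\<dots> = real R ^ 4" by (simp flip: power_add)
    finally have diff: "\<bar>?T - real (N div ?Q) * ?P\<bar> \<le> real R ^ 4" .
    have "\<bar>v D * v E\<bar> \<le> 1" unfolding abs_mult
      using tot1[OF D] tot1[OF E] by (intro mult_le_one) (auto simp: v_def abs_mult power_abs)
    then have "\<bar>(?T - real (N div ?Q) * ?P) * (v D * v E)\<bar> \<le> real R ^ 4 * 1"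
      unfolding abs_mult[of "_ - _"] using diff by (intro mult_mono) auto
    then have "?T * (v D * v E) \<le> real (N div ?Q) * ?P * (v D * v E) + real R ^ 4"
      by (simp add: algebra_simps)
    also have "real (N div ?Q) * ?P * (v D * v E) \<le> (if D = E then real N / phi D else 0)"
    proof (cases "D = E")
      case True
      have "real (N div ?Q) * real (\<Prod>D) \<le> real N"
        using True by (metis div_times_less_eq_dividend of_nat_le_iff of_nat_mult sup.idem)
      then have "real (N div ?Q) * real (\<Prod>D) * (1 / phi D) \<le> real N * (1 / phi D)"
        using tot1[OF D] by (intro mult_right_mono) auto
      then show ?thesis using True tot1[OF D] ramanujan_orthogonal[OF D'(1,2) E'(1,2)]
        by (simp add: v_def power_mult_distrib[symmetric])
    qed (use ramanujan_orthogonal[OF D'(1,2) E'(1,2)] in simp)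
    finally show ?thesis by simp
  qed
  have "real (card ?S) * G ^ 2 = (\<Sum>m\<in>?S. F m ^ 2)" using FS by simp
  also have "\<dots> \<le> (\<Sum>m\<in>{M..<M + N}. F m ^ 2)" by (intro sum_mono2) auto
  also have "\<dots> = (\<Sum>m\<in>{M..<M + N}. \<Sum>D\<in>?D. \<Sum>E\<in>?D. ramanujan D m * ramanujan E m * (v D * v E))"
    unfolding F_def power2_eq_square sum_product by (simp add: mult_ac)
  also have "\<dots> = (\<Sum>D\<in>?D. \<Sum>E\<in>?D. (\<Sum>m\<in>{M..<M + N}. ramanujan D m * ramanujan E m) * (v D * v E))"
    by (subst sum.swap, intro sum.cong refl, subst sum.swap) (simp add: sum_distrib_right)
  also have "\<dots> \<le> (\<Sum>D\<in>?D. \<Sum>E\<in>?D. (if D = E then real N / phi D else 0) + real R ^ 4)"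
    by (intro sum_mono pair)
  also have "\<dots> = real N * G + real (card ?D) * (real (card ?D) * real R ^ 4)"
    by (simp add: sum.distrib G_def sum_distrib_left)
  also have "\<dots> \<le> real N * G + real R * (real R * real R ^ 4)"
    using card_small_divisors_le[of R] by (intro add_left_mono mult_mono) auto
  also have "\<dots> = real N * G + real R ^ 6" by (simp add: eval_nat_numeral)
  finally have "real (card ?S) * G ^ 2 \<le> real N * G + real R ^ 6" .
  then have "real (card ?S) \<le> real N / G + real R ^ 6 / G ^ 2"
    using G1 by (simp add: field_simps power2_eq_square)
  also have "real R ^ 6 / G ^ 2 \<le> real R ^ 6 / 1"
    using G1 by (intro divide_left_mono) auto
  finally show ?thesis by simp
qed

text \<open>With R about N^(1/12), the error R^6 is at most sqrt N, hence at most 2 N / ln N, and G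
  \<ge> harm R / 2 \<ge> ln N / 24; together these give 26. Primes between R and w only remove more
  elements. The application has N = Y + 1 and w = Y.\<close>

lemma sifted_interval_bound:
  assumes "N \<ge> 2" "w \<ge> N - 1"
  shows "real (card {m\<in>{M..<M + N}. \<forall>p\<in>primes_upto w. \<not> p dvd m}) \<le> 26 * real N / ln (real N)"
proof -
  define R where "R = nat \<lfloor>real N powr (1/12)\<rfloor>"
  define G where "G = (\<Sum>D\<in>small_divisors R. 1 / phi D)"
  have lnN: "ln (real N) > 0" using assms by simp
  have N1: "real N powr (1/12) \<ge> 1" using assms by (intro ge_one_powr_ge_zero) auto
  have R1: "R \<ge> 1" unfolding R_def using N1 by linarith
  have Rle: "real R \<le> real N powr (1/12)" unfolding R_def using N1 by linarith
  have Rgt: "real R + 1 > real N powr (1/12)" unfolding R_def using N1 by linarith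
  have R6: "real R ^ 6 \<le> sqrt (real N)"
  proof -
    have "real R ^ 6 \<le> (real N powr (1/12)) ^ 6" using Rle by (intro power_mono) auto
    also have "\<dots> = sqrt (real N)" using assms by (simp add: powr_power powr_half_sqrt)
    finally show ?thesis .
  qed
  have Rw: "R \<le> w"
  proof -
    have "real R ^ 2 \<le> real R ^ 6" using R1 by (intro power_increasing) auto
    then have "real R ^ 2 \<le> sqrt (real N)" using R6 by linarith
    also have "\<dots> < real N" using assms real_sqrt_less_mono[of "real N" "real N ^ 2"] by (simp add: power2_eq_square)
    finally have "R ^ 2 < N" by (metis of_nat_less_iff of_nat_power)
    moreover have "R \<le> R ^ 2" using R1 by (simp add: power2_eq_square)
    ultimately show ?thesis using assms by linarith
  qed
  have "ln (real N) / 12 = ln (real N powr (1/12))" using assms by (simp add: ln_powr)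
  also have "\<dots> \<le> ln (real R + 1)" using Rgt N1 assms by (subst ln_le_cancel_iff) auto
  also have "\<dots> \<le> harm R" by (rule harm_ge_ln)
  also have "\<dots> \<le> 2 * (\<Sum>D\<in>small_divisors R. 1 / real (\<Prod>D))" by (rule harm_le_small_divisors)
  also have "(\<Sum>D\<in>small_divisors R. 1 / real (\<Prod>D)) \<le> G" unfolding G_def
  proof (rule sum_mono)
    fix D assume "D \<in> small_divisors R"
    note D = small_divisorsD[OF this]
    have "phi D \<le> real (\<Prod>D)" unfolding phi_def of_nat_prod
      using D by (intro prod_mono) (auto dest!: bspec prime_ge_2_nat)
    moreover have "phi D > 0" using phi_ge_1[OF D(2)] by linarith
    ultimately show "1 / real (\<Prod>D) \<le> 1 / phi D" by (intro divide_left_mono mult_pos_pos) auto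
  qed
  finally have G: "G \<ge> ln (real N) / 24" by simp
  have "real (card {m\<in>{M..<M + N}. \<forall>p\<in>primes_upto w. \<not> p dvd m}) \<le>
        real (card {m\<in>{M..<M + N}. \<forall>p\<in>primes_upto R. \<not> p dvd m})"
    using primes_upto_mono[OF Rw] by (intro of_nat_mono card_mono) auto
  also have "\<dots> \<le> real N / G + real R ^ 6" by (rule selberg_sieve[OF R1 G_def])
  also have "\<dots> \<le> real N / (ln (real N) / 24) + sqrt (real N)"
    using G lnN by (intro add_mono R6 divide_left_mono mult_pos_pos) auto
  also have "sqrt (real N) \<le> 2 * real N / ln (real N)"
  proof -
    have "ln (sqrt (real N)) \<le> sqrt (real N)" using ln_bound[of "sqrt (real N)"] assms by simp
    then have "ln (real N) \<le> 2 * sqrt (real N)" using assms by (simp add: ln_sqrt)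
    then have "ln (real N) * sqrt (real N) \<le> 2 * sqrt (real N) * sqrt (real N)"
      by (intro mult_right_mono) auto
    then have "ln (real N) * sqrt (real N) \<le> 2 * real N" by (simp add: mult.assoc)
    then show ?thesis using lnN by (simp add: field_simps)
  qed
  finally show ?thesis by (simp add: field_simps)
qed

section \<open>Random sieving\<close>

definition residues_met :: "int set \<Rightarrow> nat \<Rightarrow> nat" where
  "residues_met H p = card ((\<lambda>h. h mod int p) ` H)"

lemma residues_met_le:
  assumes "p > 0"
  shows "residues_met H p \<le> p"
proof -
  have "(\<lambda>h. h mod int p) ` H \<subseteq> {0..<int p}" using assms by auto
  from card_mono[OF _ this] show ?thesis by (simp add: residues_met_def)
qed

lemma residues_met_eq_card:
  assumes "H \<subseteq> {0..int Y}" "Y < p"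
  shows "residues_met H p = card H"
  unfolding residues_met_def
proof (intro card_image inj_onI)
  fix x y assume "x \<in> H" "y \<in> H" and eq: "x mod int p = y mod int p"
  then have "0 \<le> x" "x < int p" "0 \<le> y" "y < int p" using assms by auto
  then show "x = y" using eq by simp
qed

text \<open>A shift r fails exactly when r is congruent to -h for some h in H, and negation permutes
  the residue classes.\<close>

lemma card_residues_hitting:
  assumes p: "p > 0"
  shows "card {r\<in>{..<p}. \<exists>h\<in>H. int p dvd int r + h} = residues_met H p"
proof -
  let ?g = "\<lambda>c. nat ((- c) mod int p)"
  have "{r\<in>{..<p}. \<exists>h\<in>H. int p dvd int r + h} = ?g ` (\<lambda>h. h mod int p) ` H"
  proof (intro equalityI subsetI)
    fix r assume "r \<in> {r\<in>{..<p}. \<exists>h\<in>H. int p dvd int r + h}"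
    then obtain h where h: "h \<in> H" "int p dvd int r + h" "r < p" by auto
    then have "int r mod int p = (- h) mod int p" by (simp only: mod_eq_dvd_iff) simp
    then have "r = ?g (h mod int p)" using h by (simp add: mod_minus_eq)
    then show "r \<in> ?g ` (\<lambda>h. h mod int p) ` H" using h by blast
  next
    fix r assume "r \<in> ?g ` (\<lambda>h. h mod int p) ` H"
    then obtain h where h: "h \<in> H" and r: "r = nat ((- h) mod int p)" by (auto simp: mod_minus_eq)
    have "int r = (- h) mod int p" using p r by simp
    then have "int r mod int p = (- h) mod int p" by simp
    then have "int p dvd int r + h" by (simp only: mod_eq_dvd_iff) simp
    moreover have "r < p" using p r by (simp add: nat_less_iff)
    ultimately show "r \<in> {r\<in>{..<p}. \<exists>h\<in>H. int p dvd int r + h}" using h by auto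
  qed
  moreover have "inj_on ?g ((\<lambda>h. h mod int p) ` H)"
  proof (rule inj_onI)
    fix c d assume *: "c \<in> (\<lambda>h. h mod int p) ` H" "d \<in> (\<lambda>h. h mod int p) ` H" "?g c = ?g d"
    then have "(- c) mod int p = (- d) mod int p" using p by (simp add: nat_eq_iff)
    then have "c mod int p = d mod int p" by (metis mod_minus_cong minus_minus)
    then show "c = d" using * by auto
  qed
  ultimately show ?thesis by (simp add: card_image residues_met_def)
qed

section \<open>Averages over random shifts\<close>

definition primorial :: "nat \<Rightarrow> nat" where
  "primorial z = \<Prod>(primes_upto z)"

lemma primorial_pos: "primorial z > 0"
  unfolding primorial_def by (intro prod_pos) (auto simp: primes_upto_def prime_gt_0_nat)

text \<open>The set \<^term>\<open>I\<close> sifted by one residue class modulo each prime up to \<^term>\<open>z\<close>; a uniformly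
  random shift \<^term>\<open>a\<close> modulo the primorial makes these classes independent and uniform.\<close>
definition sifted :: "nat \<Rightarrow> int set \<Rightarrow> nat \<Rightarrow> int set" where
  "sifted z I a = {h\<in>I. \<forall>p\<in>primes_upto z. \<not> int p dvd int a + h}"

definition shift_avg :: "nat \<Rightarrow> (nat \<Rightarrow> real) \<Rightarrow> real" where
  "shift_avg z f = (\<Sum>a<primorial z. f a) / real (primorial z)"

lemma shift_avg_mono: "(\<And>a. f a \<le> g a) \<Longrightarrow> shift_avg z f \<le> shift_avg z g"
  unfolding shift_avg_def by (intro divide_right_mono sum_mono) auto

lemma shift_avg_const: "shift_avg z (\<lambda>_. c) = c"
  using primorial_pos[of z] by (simp add: shift_avg_def)

lemma shift_avg_add: "shift_avg z (\<lambda>a. f a + g a) = shift_avg z f + shift_avg z g"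
  by (simp add: shift_avg_def sum.distrib add_divide_distrib)

lemma shift_avg_cmult: "shift_avg z (\<lambda>a. c * f a) = c * shift_avg z f"
  by (simp add: shift_avg_def flip: sum_distrib_left)

lemma shift_avg_sum: "shift_avg z (\<lambda>a. \<Sum>i\<in>A. f i a) = (\<Sum>i\<in>A. shift_avg z (f i))"
  by (simp add: shift_avg_def sum_divide_distrib[symmetric] sum.swap[of _ _ A])

text \<open>Jensen's inequality, by averaging the tangent line bound.\<close>
lemma exp_shift_avg_le: "exp (shift_avg z f) \<le> shift_avg z (\<lambda>a. exp (f a))"
proof -
  let ?m = "shift_avg z f"
  have "exp ?m * (1 - ?m) + exp ?m * f a \<le> exp (f a)" for a
  proof -
    have "exp ?m * (1 + (f a - ?m)) \<le> exp ?m * exp (f a - ?m)"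
      by (intro mult_left_mono exp_ge_add_one_self) auto
    then show ?thesis by (simp add: algebra_simps flip: exp_add)
  qed
  then have "shift_avg z (\<lambda>a. exp ?m * (1 - ?m) + exp ?m * f a) \<le> shift_avg z (\<lambda>a. exp (f a))"
    by (rule shift_avg_mono)
  then show ?thesis
    by (simp add: shift_avg_add shift_avg_const shift_avg_cmult flip: distrib_left)
qed

definition sieve_prob :: "nat \<Rightarrow> int set \<Rightarrow> real" where
  "sieve_prob z H = (\<Prod>p\<in>primes_upto z. 1 - real (residues_met H p) / real p)"

text \<open>Survival at p depends on the shift modulo p alone and fails for
  \<open>residues_met H p\<close> of the p classes. Independence multiplies the
  probabilities.\<close>

lemma shift_avg_subset_sifted:
  assumes "H \<subseteq> I"
  shows "shift_avg z (\<lambda>a. if H \<subseteq> sifted z I a then 1 else 0) = sieve_prob z H"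
proof -
  let ?f = "\<lambda>p r. if \<exists>h\<in>H. int p dvd int r + h then 0 else (1::real)"
  have mod: "int p dvd int (a mod p) + h \<longleftrightarrow> int p dvd int a + h" for a p h
    by (simp add: zmod_int dvd_eq_mod_eq_0 mod_add_left_eq)
  have "(if H \<subseteq> sifted z I a then 1 else 0) = (\<Prod>p\<in>primes_upto z. ?f p (a mod p))" for a
  proof (cases "H \<subseteq> sifted z I a")
    case True
    then show ?thesis unfolding mod
      by (subst prod.neutral) (auto simp: sifted_def subset_iff)
  next
    case False
    then obtain p h where "p \<in> primes_upto z" "h \<in> H" "int p dvd int a + h"
      using assms by (auto simp: sifted_def)
    then have "(\<Prod>p\<in>primes_upto z. ?f p (a mod p)) = 0"
      unfolding mod by (intro prod_zero) auto
    then show ?thesis using False by simp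
  qed
  then have "shift_avg z (\<lambda>a. if H \<subseteq> sifted z I a then 1 else 0) =
      (\<Prod>p\<in>primes_upto z. \<Sum>r<p. ?f p r) / real (primorial z)"
    unfolding shift_avg_def primorial_def
    using sum_prod_mod_primes[of "primes_upto z" ?f] by (simp add: primes_upto_prime)
  also have "(\<Prod>p\<in>primes_upto z. \<Sum>r<p. ?f p r) = (\<Prod>p\<in>primes_upto z. real p - real (residues_met H p))"
  proof (intro prod.cong refl)
    fix p assume "p \<in> primes_upto z"
    then have p: "p > 0" by (auto simp: primes_upto_def prime_gt_0_nat)
    let ?A = "{r\<in>{..<p}. \<exists>h\<in>H. int p dvd int r + h}"
    have "(\<Sum>r<p. ?f p r) = (\<Sum>r<p. 1 - (if r \<in> ?A then 1 else 0))"
      by (intro sum.cong) auto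
    also have "\<dots> = real p - real (card ?A)"
      by (simp only: sum_subtractf) (simp add: sum.If_cases Int_def conj_commute)
    finally show "(\<Sum>r<p. ?f p r) = real p - real (residues_met H p)"
      using card_residues_hitting[OF p] by simp
  qed
  also have "\<dots> / real (primorial z) = sieve_prob z H"
    unfolding sieve_prob_def primorial_def of_nat_prod prod_dividef[symmetric]
    by (intro prod.cong) (auto simp: primes_upto_def diff_divide_distrib dest: prime_gt_0_nat)
  finally show ?thesis .
qed

abbreviation subsets_of_card :: "'a set \<Rightarrow> nat \<Rightarrow> 'a set set" where
  "subsets_of_card I k \<equiv> {H. H \<subseteq> I \<and> card H = k}"

lemma finite_subsets_of_card: "finite I \<Longrightarrow> finite (subsets_of_card I k)"
  by (rule finite_subset[of _ "Pow I"]) auto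

text \<open>Both sides are the expected number of k-element sets of survivors, that is, the k-th
  binomial moment of the sifted set.\<close>

lemma sum_sieve_prob:
  assumes "finite I"
  shows "(\<Sum>H\<in>subsets_of_card I k. sieve_prob z H) =
         shift_avg z (\<lambda>a. real (card (sifted z I a) choose k))"
proof -
  have "real (card (sifted z I a) choose k) =
        (\<Sum>H\<in>subsets_of_card I k. if H \<subseteq> sifted z I a then 1 else 0)" for a
  proof -
    have sub: "sifted z I a \<subseteq> I" by (auto simp: sifted_def)
    then have "subsets_of_card I k \<inter> {H. H \<subseteq> sifted z I a} = subsets_of_card (sifted z I a) k"
      by auto
    then show ?thesis
      using assms sub finite_subset[OF sub] finite_subsets_of_card[OF assms, of k]
      by (simp add: sum.If_cases n_subsets)
  qed
  then have "shift_avg z (\<lambda>a. real (card (sifted z I a) choose k)) =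
      (\<Sum>H\<in>subsets_of_card I k. shift_avg z (\<lambda>a. if H \<subseteq> sifted z I a then 1 else 0))"
    by (simp add: shift_avg_sum)
  also have "\<dots> = (\<Sum>H\<in>subsets_of_card I k. sieve_prob z H)"
    by (intro sum.cong shift_avg_subset_sifted) auto
  finally show ?thesis ..
qed

lemma shift_avg_card_sifted:
  assumes "finite I"
  shows "shift_avg z (\<lambda>a. real (card (sifted z I a))) = real (card I) * sieve_density z"
proof -
  have "sieve_prob z H = sieve_density z" if "card H = 1" for H
  proof -
    from that obtain h where "H = {h}" by (auto simp: card_1_singleton_iff)
    then show ?thesis by (simp add: sieve_prob_def sieve_density_def residues_met_def)
  qed
  then have "(\<Sum>H\<in>subsets_of_card I 1. sieve_prob z H) = (\<Sum>H\<in>subsets_of_card I 1. sieve_density z)"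
    by (intro sum.cong) auto
  then show ?thesis
    using sum_sieve_prob[OF assms, of z 1] n_subsets[OF assms, of 1] by simp
qed

section \<open>Local factors and partial products of the singular series\<close>

definition local_factor :: "int set \<Rightarrow> nat \<Rightarrow> real" where
  "local_factor H p = (1 - real (residues_met H p) / real p) / (1 - 1 / real p) ^ card H"

definition partial_series :: "nat \<Rightarrow> int set \<Rightarrow> real" where
  "partial_series z H = (\<Prod>p\<in>primes_upto z. local_factor H p)"

lemma partial_series_eq: "partial_series z H = sieve_prob z H / sieve_density z ^ card H"
  unfolding partial_series_def local_factor_def sieve_prob_def sieve_density_def
  by (simp add: prod_dividef prod_power_distrib)

lemma local_factor_nonneg:
  assumes "prime p"
  shows "local_factor H p \<ge> 0"
  using residues_met_le[of p H] prime_gt_1_nat[OF assms]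
  unfolding local_factor_def by (intro divide_nonneg_nonneg zero_le_power) auto

lemma partial_series_nonneg: "partial_series z H \<ge> 0"
  unfolding partial_series_def by (intro prod_nonneg) (auto intro: local_factor_nonneg primes_upto_prime)

lemma local_factor_le_1:
  assumes "prime p" "residues_met H p = card H"
  shows "local_factor H p \<le> 1"
proof -
  have p: "real p > 1" using prime_gt_1_nat[OF assms(1)] by simp
  have "1 + real (card H) * (- 1 / real p) \<le> (1 + (- 1 / real p)) ^ card H"
    using p by (intro Bernoulli_inequality) (simp add: field_simps)
  then show ?thesis using p unfolding local_factor_def assms(2)
    by (subst divide_le_eq_1_pos) (auto intro!: zero_less_power simp: field_simps)
qed

text \<open>With k = |H|, Bernoulli gives (1 + k/p) (1 - 1/p)^k \<le> (1 - 1/p^2)^k \<le> 1;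
  multiply by 1 - k/p. The deficit is quadratic in 1/p, so the tail of the Euler product is
  controlled.\<close>

lemma local_factor_ge:
  assumes "prime p" "residues_met H p = card H" "card H \<le> p"
  shows "local_factor H p \<ge> 1 - (real (card H) / real p) ^ 2"
proof -
  let ?k = "real (card H)"
  have p: "real p > 1" using prime_gt_1_nat[OF assms(1)] by simp
  have pw: "(1 - 1 / real p) ^ card H > 0" using p by auto
  have "(1 - (?k / real p) ^ 2) * (1 - 1 / real p) ^ card H \<le> (1 - ?k / real p) * 1"
  proof -
    have "(1 + ?k * (1 / real p)) * (1 - 1 / real p) ^ card H \<le>
          (1 + 1 / real p) ^ card H * (1 - 1 / real p) ^ card H"
      using p pw by (intro mult_right_mono Bernoulli_inequality) (auto intro: order_trans[of _ 0])
    also have "\<dots> = (1 - 1 / real p ^ 2) ^ card H"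
      by (simp add: power_mult_distrib[symmetric] algebra_simps power2_eq_square)
    also have "\<dots> \<le> 1" using p by (intro power_le_one) auto
    finally have "(1 - ?k / real p) * ((1 + ?k * (1 / real p)) * (1 - 1 / real p) ^ card H) \<le> (1 - ?k / real p) * 1"
      using assms p by (intro mult_left_mono) auto
    moreover have "1 - (?k / real p) ^ 2 = (1 - ?k / real p) * (1 + ?k * (1 / real p))"
      by (simp add: algebra_simps power2_eq_square)
    ultimately show ?thesis by (simp add: mult.assoc)
  qed
  then show ?thesis using pw unfolding local_factor_def assms(2) by (simp add: pos_le_divide_eq)
qed

text \<open>Beyond Y the elements of H are distinct modulo p, so every further factor is at most 1.
  This permits lowering the level to Y, where sieve and Mertens bounds match.\<close>

lemma partial_series_antimono:
  assumes "H \<subseteq> {0..int Y}" "Y \<le> w" "w \<le> z"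
  shows "partial_series z H \<le> partial_series w H"
  unfolding partial_series_def
proof (rule prod_le_prod_subset)
  fix p assume p: "p \<in> primes_upto z - primes_upto w"
  then have "prime p" "Y < p" using assms by (auto simp: primes_upto_def)
  then show "local_factor H p \<le> 1"
    using residues_met_eq_card[OF assms(1)] by (intro local_factor_le_1) auto
qed (use assms primes_upto_mono[of w z] in \<open>auto intro: local_factor_nonneg primes_upto_prime\<close>)

lemma sum_partial_series:
  assumes "finite I"
  shows "(\<Sum>H\<in>subsets_of_card I k. partial_series z H) =
         shift_avg z (\<lambda>a. real (card (sifted z I a) choose k)) / sieve_density z ^ k"
  by (simp add: sum_sieve_prob[OF assms, symmetric] sum_divide_distrib partial_series_eq)

text \<open>Translation by a turns the survivors into the integers of [a, a + Y] without prime
  factor up to Y. The bound holds for every shift, not just on average, so it can be raised to the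
  k-th power.\<close>

lemma card_sifted_interval_le:
  assumes "Y \<ge> 1"
  shows "real (card (sifted Y {0..int Y} a)) \<le> 26 * real (Y + 1) / ln (real (Y + 1))"
proof -
  let ?B = "{m\<in>{a..<a + (Y + 1)}. \<forall>p\<in>primes_upto Y. \<not> p dvd m}"
  have "sifted Y {0..int Y} a = (\<lambda>m. int m - int a) ` ?B"
  proof (intro equalityI subsetI)
    fix h assume h: "h \<in> sifted Y {0..int Y} a"
    then have "int a + h = int (nat (int a + h))" by (simp add: sifted_def)
    then show "h \<in> (\<lambda>m. int m - int a) ` ?B"
      using h by (intro image_eqI[of _ _ "nat (int a + h)"])
        (auto simp: sifted_def nat_less_iff nat_le_iff le_nat_iff simp flip: int_dvd_int_iff)
  qed (auto simp: sifted_def)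
  then have "card (sifted Y {0..int Y} a) = card ?B"
    by (simp add: card_image inj_on_def)
  then show ?thesis using sifted_interval_bound[of "Y + 1" Y a] assms by simp
qed

text \<open>The level is first lowered from z to Y, which is why z is absent from the bound. There
  the binomial coefficient is at most the k-th power of the sieve bound over k!, and 572 = 26 *
  22.\<close>

lemma sum_partial_series_le:
  assumes "Y \<ge> 2" "Y \<le> z"
  shows "(\<Sum>H\<in>subsets_of_card {0..int Y} k. partial_series z H) \<le> (572 * real (Y + 1)) ^ k / fact k"
proof -
  let ?I = "{0..int Y}" and ?N = "real (Y + 1)"
  have ln: "ln ?N > 0" using assms by simp
  have power_div_mult: "x ^ k / fact k * y ^ k = (x * y) ^ k / fact k" for x y :: real
    by (simp add: power_mult_distrib)
  have "(\<Sum>H\<in>subsets_of_card ?I k. partial_series z H) \<le> (\<Sum>H\<in>subsets_of_card ?I k. partial_series Y H)"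
    using assms by (intro sum_mono partial_series_antimono[of _ Y]) auto
  also have "\<dots> = shift_avg Y (\<lambda>a. real (card (sifted Y ?I a) choose k)) * (1 / sieve_density Y) ^ k"
    by (simp add: sum_partial_series power_one_over)
  also have "\<dots> \<le> (26 * ?N / ln ?N) ^ k / fact k * (22 * ln ?N) ^ k"
  proof (rule mult_mono)
    have "real (card (sifted Y ?I a) choose k) \<le> (26 * ?N / ln ?N) ^ k / fact k" for a
    proof -
      have "real (card (sifted Y ?I a) choose k) * fact k \<le> real (card (sifted Y ?I a)) ^ k"
        using binomial_fact_pow[of "card (sifted Y ?I a)" k]
        by (metis of_nat_fact of_nat_le_iff of_nat_mult of_nat_power)
      also have "\<dots> \<le> (26 * ?N / ln ?N) ^ k"
        using assms by (intro power_mono card_sifted_interval_le) auto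
      finally show ?thesis by (simp add: pos_le_divide_eq del: of_nat_Suc)
    qed
    then have "shift_avg Y (\<lambda>a. real (card (sifted Y ?I a) choose k)) \<le>
          shift_avg Y (\<lambda>_. (26 * ?N / ln ?N) ^ k / fact k)"
      by (rule shift_avg_mono)
    then show "shift_avg Y (\<lambda>a. real (card (sifted Y ?I a) choose k)) \<le> (26 * ?N / ln ?N) ^ k / fact k"
      by (simp only: shift_avg_const)
    have "1 / sieve_density Y \<le> 22 * ln (real Y)"
      using assms by (intro sieve_density_inverse_le) auto
    also have "\<dots> \<le> 22 * ln ?N" using assms by simp
    finally show "(1 / sieve_density Y) ^ k \<le> (22 * ln ?N) ^ k"
      using sieve_density_pos[of Y] by (intro power_mono) auto
  qed (use ln sieve_density_pos[of Y] in auto)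
  also have "\<dots> = (26 * ?N / ln ?N * (22 * ln ?N)) ^ k / fact k"
    by (rule power_div_mult)
  also have "26 * ?N / ln ?N * (22 * ln ?N) = 572 * ?N" using ln by simp
  finally show ?thesis .
qed

section \<open>Truncating the singular series\<close>

lemma singular_series_conv: "singular_series H = (\<Prod>p. if prime p then local_factor H p else 1)"
  unfolding singular_series_def local_factor_def residues_met_def
  by (intro arg_cong[where f = prodinf] ext) (simp add: power_int_minus divide_inverse)

lemma sum_recip_squares_gt_le: "(\<Sum>p\<in>{z<..n}. 1 / real p ^ 2) \<le> 1 / real z" if "z \<ge> 1"
proof (cases "z \<le> n")
  case True
  have "(\<Sum>p\<in>{z<..n}. 1 / real p ^ 2) \<le> 1 / real z - 1 / real n" using True
  proof (induction n rule: dec_induct)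
    case (step n)
    have "1 / real (Suc n) ^ 2 \<le> 1 / real n - 1 / real (Suc n)"
      using step that by (intro recip_square_le) auto
    moreover have "{z<..Suc n} = insert (Suc n) {z<..n}" using step by auto
    ultimately show ?case using step by simp
  qed simp
  then show ?thesis by (rule order_trans) simp
qed simp

text \<open>Each factor beyond z lies between 1 - (|H|/p)^2 and 1. The Weierstrass inequality and
  the tail bound 1/z for the sum of 1/p^2 put the product of these factors between 1 - |H|^2/z and
  1.\<close>

lemma singular_series_bounds:
  assumes H: "H \<subseteq> {0..int Y}" and z: "Y \<le> z" "card H \<le> z" "z \<ge> 1"
  shows "singular_series H \<le> partial_series z H"
    and "(1 - real (card H) ^ 2 / real z) * partial_series z H \<le> singular_series H"
proof -
  define f where "f = (\<lambda>p. if prime p then local_factor H p else 1)"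
  let ?k = "real (card H)"
  have f_le: "f p \<le> 1" and f_ge: "f p \<ge> 1 - (?k / real p) ^ 2" if "z < p" for p
    using that z residues_met_eq_card[OF H, of p] local_factor_le_1[of p H] local_factor_ge[of p H]
    by (auto simp: f_def)
  have f0: "f p \<ge> 0" for p using local_factor_nonneg by (simp add: f_def)
  have "summable (\<lambda>p. ?k ^ 2 * (1 / real p ^ 2))"
    using inverse_power_summable[of 2, where ?'a = real] by (intro summable_mult) (simp add: divide_inverse)
  then have "summable (\<lambda>p. norm (f p - 1))"
  proof (rule summable_comparison_test_ev[rotated])
    show "\<forall>\<^sub>F p in sequentially. norm (norm (f p - 1)) \<le> ?k ^ 2 * (1 / real p ^ 2)"
      using eventually_gt_at_top[of z]
    proof eventually_elim
      case (elim p)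
      then show ?case using f_le[of p] f_ge[of p] by (simp add: power_divide)
    qed
  qed
  then have "convergent_prod f"
    by (intro abs_convergent_prod_imp_convergent_prod) (simp add: abs_convergent_prod_conv_summable)
  then have lim: "(\<lambda>n. \<Prod>p\<le>n. f p) \<longlonglongrightarrow> singular_series H"
    using convergent_prod_LIMSEQ[of f] by (simp add: singular_series_conv f_def)
  have split: "(\<Prod>p\<le>n. f p) = partial_series z H * (\<Prod>p\<in>{z<..n}. f p)" if "z \<le> n" for n
  proof -
    have "{..n} = {..z} \<union> {z<..n}" using that by auto
    then have "(\<Prod>p\<le>n. f p) = (\<Prod>p\<le>z. f p) * (\<Prod>p\<in>{z<..n}. f p)"
      by (simp only:) (rule prod.union_disjoint; auto)
    moreover have "(\<Prod>p\<le>z. f p) = partial_series z H"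
      unfolding partial_series_def f_def primes_upto_def
      by (simp add: prod.If_cases Int_def conj_commute)
    ultimately show ?thesis by simp
  qed
  have tail_le: "(\<Prod>p\<in>{z<..n}. f p) \<le> 1" for n
    using f_le f0 by (intro prod_le_1) auto
  have tail_ge: "(\<Prod>p\<in>{z<..n}. f p) \<ge> 1 - ?k ^ 2 / real z" for n
  proof -
    have "1 - ?k ^ 2 / real z \<le> 1 - ?k ^ 2 * (\<Sum>p\<in>{z<..n}. 1 / real p ^ 2)"
      using mult_left_mono[OF sum_recip_squares_gt_le[OF z(3), of n], of "?k ^ 2"] by simp
    also have "\<dots> = 1 - (\<Sum>p\<in>{z<..n}. (?k / real p) ^ 2)"
      by (simp add: sum_distrib_left power_divide)
    also have "\<dots> \<le> (\<Prod>p\<in>{z<..n}. 1 - (?k / real p) ^ 2)"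
    proof (rule Weierstrass_prod_ineq)
      fix p assume "p \<in> {z<..n}"
      then have "?k / real p \<le> 1" using z by simp
      then show "(?k / real p) ^ 2 \<in> {0..1}" by (simp add: power_le_one)
    qed
    also have "\<dots> \<le> (\<Prod>p\<in>{z<..n}. f p)"
    proof (intro prod_mono conjI)
      fix p assume p: "p \<in> {z<..n}"
      then have "?k / real p \<le> 1" using z by simp
      then show "0 \<le> 1 - (?k / real p) ^ 2" by (simp add: power_le_one)
      show "1 - (?k / real p) ^ 2 \<le> f p" using p by (intro f_ge) auto
    qed
    finally show ?thesis .
  qed
  show "singular_series H \<le> partial_series z H"
  proof (rule LIMSEQ_le_const2[OF lim], intro exI allI impI)
    fix n assume "z \<le> n"
    then show "(\<Prod>p\<le>n. f p) \<le> partial_series z H"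
      using mult_left_mono[OF tail_le[of n] partial_series_nonneg[of z H]] by (simp add: split)
  qed
  show "(1 - ?k ^ 2 / real z) * partial_series z H \<le> singular_series H"
  proof (rule LIMSEQ_le_const[OF lim], intro exI allI impI)
    fix n assume "z \<le> n"
    then show "(1 - ?k ^ 2 / real z) * partial_series z H \<le> (\<Prod>p\<le>n. f p)"
      using mult_right_mono[OF tail_ge[of n] partial_series_nonneg[of z H]] by (simp add: split mult.commute)
  qed
qed

lemma singular_series_nonneg:
  assumes "H \<subseteq> {0..int Y}"
  shows "singular_series H \<ge> 0"
proof -
  \<comment> \<open>At least |H|^2, so that the factor in the lower bound is nonnegative.\<close>
  define z where "z = Suc Y + card H ^ 2"
  have "card H \<le> card H ^ 2" by (simp add: power2_eq_square)
  then have z: "Y \<le> z" "card H \<le> z" "z \<ge> 1" by (auto simp: z_def)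
  have "real (card H) ^ 2 \<le> real z"
    unfolding z_def by (metis le_add2 of_nat_le_iff of_nat_power)
  then have "0 \<le> (1 - real (card H) ^ 2 / real z) * partial_series z H"
    using z by (intro mult_nonneg_nonneg partial_series_nonneg) (simp add: divide_le_eq)
  also have "\<dots> \<le> singular_series H" by (rule singular_series_bounds(2)[OF assms z])
  finally show ?thesis .
qed

section \<open>The main term\<close>

text \<open>Pascal's rule reduces the case $(K + 1, N + 1)$ to $(K + 1, N)$ and $(K, N)$.\<close>
lemma bonferroni:
  fixes q :: real
  assumes "0 \<le> q" "q \<le> 1"
  shows "(- 1) ^ K * ((\<Sum>k\<le>K. (- q) ^ k * real (N choose k)) - (1 - q) ^ N) \<ge> 0"
proof (induction N arbitrary: K)
  case 0
  have "(\<Sum>k\<le>K. (- q) ^ k * real (0 choose k)) = (\<Sum>k\<in>{0}. (- q) ^ k * real (0 choose k))"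
    by (rule sum.mono_neutral_right) (auto simp: binomial_eq_0)
  then show ?case by simp
next
  case (Suc N)
  let ?T = "\<lambda>K N. \<Sum>k\<le>K. (- q) ^ k * real (N choose k)"
  show ?case
  proof (cases K)
    case 0
    then show ?thesis using power_le_one[of "1 - q" "Suc N"] assms by simp
  next
    case (Suc J)
    have shift: "?T K M = 1 + (\<Sum>k\<le>J. (- q) ^ Suc k * real (M choose Suc k))" for M
      unfolding Suc by (subst sum.atMost_Suc_shift) simp
    have "(\<Sum>k\<le>J. (- q) ^ Suc k * real (Suc N choose Suc k)) =
        (\<Sum>k\<le>J. (- q) ^ Suc k * real (N choose Suc k) - q * ((- q) ^ k * real (N choose k)))"
      by (intro sum.cong) (simp_all add: algebra_simps)
    then have pascal: "?T K (Suc N) = ?T K N - q * ?T J N"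
      unfolding shift by (simp only: sum_subtractf sum_distrib_left add_diff_eq)
    have sgn: "(- 1) ^ K = - ((- 1 :: real) ^ J)" by (simp add: Suc)
    have "(- 1) ^ K * (?T K (Suc N) - (1 - q) ^ Suc N) =
        (- 1) ^ K * (?T K N - (1 - q) ^ N) + q * ((- 1) ^ J * (?T J N - (1 - q) ^ N))"
      unfolding pascal sgn power_Suc by (simp add: algebra_simps)
    also have "\<dots> \<ge> 0"
      by (rule add_nonneg_nonneg[OF Suc.IH mult_nonneg_nonneg[OF assms(1) Suc.IH]])
    finally show ?thesis .
  qed
qed

text \<open>Puts the power (1 - q)^n into a form with exponent linear in n, so that Jensen needs
  only the mean of n. The restriction q \<le> 1/2 enters here.\<close>

lemma one_minus_ge_exp:
  fixes q :: real
  assumes "0 \<le> q" "q \<le> 1 / 2"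
  shows "exp (- 2 * q) \<le> 1 - q"
proof -
  have "1 \<le> (1 - q) * (1 + 2 * q)"
  proof -
    have "(1 - q) * (1 + 2 * q) = 1 + q * (1 - 2 * q)" by (simp add: algebra_simps)
    then show ?thesis using assms by simp
  qed
  also have "\<dots> \<le> (1 - q) * exp (2 * q)"
    using assms by (intro mult_left_mono exp_ge_add_one_self) auto
  finally show ?thesis by (simp add: exp_minus field_simps)
qed

lemma sum_power_div_fact_le_exp: "\<mu> \<ge> 0 \<Longrightarrow> (\<Sum>k\<le>K. \<mu> ^ k / fact k) \<le> exp (\<mu>::real)"
proof -
  assume \<mu>: "\<mu> \<ge> 0"
  have sums: "(\<lambda>k. \<mu> ^ k / fact k) sums exp \<mu>"
    using exp_converges[of \<mu>] by (simp add: divide_inverse mult.commute)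
  have "(\<Sum>k\<le>K. \<mu> ^ k / fact k) \<le> (\<Sum>k. \<mu> ^ k / fact k)"
    using \<mu> sums by (intro sum_le_suminf) (auto simp: sums_iff)
  then show ?thesis using sums by (simp add: sums_iff)
qed

lemma main_term_ge:
  fixes u :: real
  defines "a \<equiv> \<lambda>Y k. \<Sum>H\<in>subsets_of_card {0..int Y} k. singular_series H"
  assumes Y: "Y \<ge> 2" "Y \<le> z" and K: "odd K" "K \<le> z"
    and u: "u > 0" "1 / (sieve_density z * u) \<le> 1 / 2"
  shows "(\<Sum>k\<le>K. (- 1) ^ k * a Y k / u ^ k) \<ge>
    exp (- 2 * real (Y + 1) / u) - (572 * real (Y + 1) / u) ^ K / fact K
      - real K ^ 2 / real z * exp (572 * real (Y + 1) / u)"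
proof -
  let ?I = "{0..int Y}" and ?N = "real (Y + 1)"
  define q where "q = 1 / (sieve_density z * u)"
  define b where "b = (\<lambda>k. \<Sum>H\<in>subsets_of_card ?I k. partial_series z H)"
  define n where "n = (\<lambda>x. card (sifted z ?I x))"
  let ?\<mu> = "572 * ?N / u"
  have q: "0 \<le> q" "q \<le> 1 / 2" using u sieve_density_pos[of z] by (auto simp: q_def)
  have b_eq: "b k / u ^ k = q ^ k * shift_avg z (\<lambda>x. real (n x choose k))" for k
    by (simp add: b_def sum_partial_series q_def n_def power_divide power_mult_distrib)
  have b0: "b k \<ge> 0" for k unfolding b_def by (intro sum_nonneg partial_series_nonneg)
  have b_le: "b k / u ^ k \<le> ?\<mu> ^ k / fact k" for k
  proof -
    have "b k / u ^ k \<le> ((572 * ?N) ^ k / fact k) / u ^ k"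
      using u sum_partial_series_le[OF Y, of k] unfolding b_def by (intro divide_right_mono) auto
    then show ?thesis by (simp add: power_divide mult.commute)
  qed
  \<comment> \<open>Bonferroni at the even order J bounds (1 - q)^n from above. The sum up to K
    differs by the negative term k = K, which is then paid for separately.\<close>
  obtain J where J: "K = Suc J" "even J" using K by (cases K) auto
  have diff: "\<bar>b k - a Y k\<bar> \<le> real K ^ 2 / real z * b k" if "k \<le> K" for k
  proof -
    have "a Y k \<le> b k" unfolding a_def b_def
      using that Y K by (intro sum_mono singular_series_bounds(1)[of _ Y]) auto
    moreover have "(1 - real K ^ 2 / real z) * b k \<le> a Y k" unfolding a_def b_def sum_distrib_left
    proof (rule sum_mono)
      fix H assume H: "H \<in> subsets_of_card ?I k"
      have "(1 - real K ^ 2 / real z) * partial_series z H \<le> (1 - real (card H) ^ 2 / real z) * partial_series z H"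
        using H that by (intro mult_right_mono partial_series_nonneg diff_mono divide_right_mono power_mono) auto
      also have "\<dots> \<le> singular_series H"
        using H that Y K by (intro singular_series_bounds(2)[of _ Y]) auto
      finally show "(1 - real K ^ 2 / real z) * partial_series z H \<le> singular_series H" .
    qed
    ultimately show ?thesis by (simp add: algebra_simps)
  qed
  \<comment> \<open>The mean number of survivors is Y + 1 times the density, and q was normalised by
    the same density: z cancels from the exponent.\<close>
  have "shift_avg z (\<lambda>x. - 2 * q * real (n x)) = - 2 * (q * sieve_density z) * ?N"
    unfolding shift_avg_cmult n_def by (simp add: shift_avg_card_sifted)
  moreover have "q * sieve_density z = 1 / u" using sieve_density_pos[of z] by (simp add: q_def)
  ultimately have "exp (- 2 * ?N / u) = exp (shift_avg z (\<lambda>x. - 2 * q * real (n x)))"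
    by (simp only: times_divide_eq_right times_divide_eq_left mult_1_right)
  also have "\<dots> \<le> shift_avg z (\<lambda>x. exp (- 2 * q * real (n x)))" by (rule exp_shift_avg_le)
  also have "\<dots> \<le> shift_avg z (\<lambda>x. \<Sum>k\<le>J. (- q) ^ k * real (n x choose k))"
  proof (rule shift_avg_mono)
    fix x
    have "exp (- 2 * q * real (n x)) = exp (- 2 * q) ^ n x"
      by (simp add: mult.commute flip: exp_of_nat_mult)
    also have "\<dots> \<le> (1 - q) ^ n x" using q by (intro power_mono one_minus_ge_exp) auto
    also have "\<dots> \<le> (\<Sum>k\<le>J. (- q) ^ k * real (n x choose k))"
      using bonferroni[of q J "n x"] q J(2) by simp
    finally show "exp (- 2 * q * real (n x)) \<le> (\<Sum>k\<le>J. (- q) ^ k * real (n x choose k))" .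
  qed
  also have "\<dots> = (\<Sum>k\<le>J. (- 1) ^ k * b k / u ^ k)"
    unfolding shift_avg_sum shift_avg_cmult
    by (intro sum.cong) (simp_all add: b_eq power_minus[of q] flip: times_divide_eq_right)
  also have "\<dots> = (\<Sum>k\<le>K. (- 1) ^ k * b k / u ^ k) + b K / u ^ K"
    using J by simp
  finally have 1: "exp (- 2 * ?N / u) \<le> (\<Sum>k\<le>K. (- 1) ^ k * b k / u ^ k) + ?\<mu> ^ K / fact K"
    using b_le[of K] by linarith
  have "(\<Sum>k\<le>K. (- 1) ^ k * b k / u ^ k) - (\<Sum>k\<le>K. (- 1) ^ k * a Y k / u ^ k) =
      (\<Sum>k\<le>K. (- 1) ^ k * (b k - a Y k) / u ^ k)"
    by (simp add: sum_subtractf[symmetric] algebra_simps diff_divide_distrib)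
  also have "\<dots> \<le> (\<Sum>k\<le>K. real K ^ 2 / real z * (?\<mu> ^ k / fact k))"
  proof (rule sum_mono)
    fix k assume "k \<in> {..K}"
    then have k: "k \<le> K" by simp
    have "(- 1) ^ k * (b k - a Y k) / u ^ k \<le> \<bar>(- 1) ^ k * (b k - a Y k) / u ^ k\<bar>" by (rule abs_ge_self)
    also have "\<dots> = \<bar>b k - a Y k\<bar> / u ^ k" using u by (simp add: abs_mult power_abs)
    also have "\<dots> \<le> real K ^ 2 / real z * b k / u ^ k"
      using u by (intro divide_right_mono diff k) auto
    also have "\<dots> = real K ^ 2 / real z * (b k / u ^ k)" by simp
    also have "\<dots> \<le> real K ^ 2 / real z * (?\<mu> ^ k / fact k)"
      by (intro mult_left_mono b_le) auto
    finally show "(- 1) ^ k * (b k - a Y k) / u ^ k \<le> real K ^ 2 / real z * (?\<mu> ^ k / fact k)" .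
  qed
  also have "\<dots> = real K ^ 2 / real z * (\<Sum>k\<le>K. ?\<mu> ^ k / fact k)" by (simp only: sum_distrib_left)
  also have "\<dots> \<le> real K ^ 2 / real z * exp ?\<mu>"
    using u by (intro mult_left_mono sum_power_div_fact_le_exp) auto
  finally show ?thesis using 1 by linarith
qed

text \<open>The bound for partial products does not depend on the level, so any level at least Y and
  k will do; \<open>Y + k\<close> is one.\<close>

lemma sum_singular_series_le:
  assumes "Y \<ge> 2"
  shows "(\<Sum>H\<in>subsets_of_card {0..int Y} k. singular_series H) \<le> (572 * real (Y + 1)) ^ k / fact k"
proof -
  have "(\<Sum>H\<in>subsets_of_card {0..int Y} k. singular_series H) \<le>
        (\<Sum>H\<in>subsets_of_card {0..int Y} k. partial_series (Y + k) H)"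
    using assms by (intro sum_mono singular_series_bounds(1)[of _ Y]) auto
  also have "\<dots> \<le> (572 * real (Y + 1)) ^ k / fact k"
    using assms by (intro sum_partial_series_le) auto
  finally show ?thesis .
qed

section \<open>From tuple counts to gaps\<close>

text \<open>For fixed n, the sets H counted are the k-subsets of the h in [0, Y] with n + h in A.
  Bonferroni applies with q = 1, where (1 - q)^N is the indicator of N = 0.\<close>

lemma sum_tuple_count_le:
  assumes "odd K"
  shows "(\<Sum>k\<le>K. (- 1) ^ k * (\<Sum>H\<in>subsets_of_card {0..int Y} k. real (tuple_count A H x))) \<le>
    real (card {n::nat. 1 \<le> n \<and> real n \<le> x \<and> {n..n + Y} \<inter> A = {}})"
proof -
  let ?I = "{0..int Y}"
  define B where "B = {n::nat. 1 \<le> n \<and> real n \<le> x}"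
  have "B \<subseteq> {..nat \<lfloor>x\<rfloor>}" by (auto simp: B_def le_nat_floor)
  then have finB: "finite B" by (rule finite_subset) simp
  define T where "T = (\<lambda>n::nat. {h\<in>?I. int n + h \<in> int ` A})"
  have T: "T n \<subseteq> ?I" "finite (T n)" for n
    unfolding T_def by auto (rule finite_subset[of _ ?I]; auto)
  have count: "(\<Sum>H\<in>subsets_of_card ?I k. real (tuple_count A H x)) = (\<Sum>n\<in>B. real (card (T n) choose k))" for k
  proof -
    have "real (tuple_count A H x) = (\<Sum>n\<in>B. if H \<subseteq> T n then 1 else 0)" if "H \<in> subsets_of_card ?I k" for H
    proof -
      have "{n. 1 \<le> n \<and> real n \<le> x \<and> (\<forall>h\<in>H. int n + h \<in> int ` A)} = {n\<in>B. H \<subseteq> T n}"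
        using that by (auto simp: B_def T_def)
      then show ?thesis using finB by (simp add: tuple_count_def sum.If_cases Int_def)
    qed
    then have "(\<Sum>H\<in>subsets_of_card ?I k. real (tuple_count A H x)) =
        (\<Sum>n\<in>B. \<Sum>H\<in>subsets_of_card ?I k. if H \<subseteq> T n then 1 else 0)"
      by (subst sum.swap) simp
    also have "\<dots> = (\<Sum>n\<in>B. real (card (T n) choose k))"
    proof (intro sum.cong refl)
      fix n
      have "subsets_of_card ?I k \<inter> {H. H \<subseteq> T n} = subsets_of_card (T n) k" using T(1)[of n] by auto
      then show "(\<Sum>H\<in>subsets_of_card ?I k. if H \<subseteq> T n then 1 else 0) = real (card (T n) choose k)"
        using finite_subsets_of_card[of ?I k] T(2)[of n] by (simp add: sum.If_cases n_subsets)
    qed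
    finally show ?thesis .
  qed
  have T_empty: "T n = {} \<longleftrightarrow> {n..n + Y} \<inter> A = {}" for n
  proof
    assume *: "T n = {}"
    show "{n..n + Y} \<inter> A = {}"
    proof (rule ccontr)
      assume "{n..n + Y} \<inter> A \<noteq> {}"
      then obtain m where "m \<in> A" "n \<le> m" "m \<le> n + Y" by auto
      then have "int m - int n \<in> T n" by (auto simp: T_def)
      then show False using * by simp
    qed
  next
    assume *: "{n..n + Y} \<inter> A = {}"
    show "T n = {}"
    proof (rule ccontr)
      assume "T n \<noteq> {}"
      then obtain h m where "0 \<le> h" "h \<le> int Y" "m \<in> A" "int n + h = int m" by (auto simp: T_def)
      then have "m \<in> {n..n + Y} \<inter> A" by auto
      then show False using * by simp
    qed
  qed
  have "(\<Sum>k\<le>K. (- 1) ^ k * (\<Sum>H\<in>subsets_of_card ?I k. real (tuple_count A H x))) =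
      (\<Sum>n\<in>B. \<Sum>k\<le>K. (- 1) ^ k * real (card (T n) choose k))"
    unfolding count sum_distrib_left by (rule sum.swap)
  also have "\<dots> \<le> (\<Sum>n\<in>B. if T n = {} then 1 else 0)"
  proof (rule sum_mono)
    fix n
    show "(\<Sum>k\<le>K. (- 1) ^ k * real (card (T n) choose k)) \<le> (if T n = {} then 1 else 0)"
      using bonferroni[of 1 K "card (T n)"] assms T(2)[of n] by (simp add: power_0_left)
  qed
  also have "\<dots> = real (card {n\<in>B. T n = {}})" using finB by (simp add: sum.If_cases Int_def)
  also have "{n\<in>B. T n = {}} = {n. 1 \<le> n \<and> real n \<le> x \<and> {n..n + Y} \<inter> A = {}}"
    by (auto simp: B_def T_empty)
  finally show ?thesis .
qed

lemma largest_gap_ge: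
  assumes "real (card {n::nat. 1 \<le> n \<and> real n \<le> x \<and> {n..n + Y} \<inter> A = {}}) > real Y"
  shows "largest_gap A x \<ge> Y"
proof -
  let ?B = "{n::nat. 1 \<le> n \<and> real n \<le> x \<and> {n..n + Y} \<inter> A = {}}"
  \<comment> \<open>At most Y of the counted n have an interval reaching past x, so more than Y of
    them leave one with n + Y \<le> x.\<close>
  have "\<not> ?B \<subseteq> {n. n \<le> nat \<lfloor>x\<rfloor> \<and> nat \<lfloor>x\<rfloor> < n + Y}"
  proof
    assume "?B \<subseteq> {n. n \<le> nat \<lfloor>x\<rfloor> \<and> nat \<lfloor>x\<rfloor> < n + Y}"
    also have "\<dots> \<subseteq> {Suc (nat \<lfloor>x\<rfloor>) - Y..nat \<lfloor>x\<rfloor>}" by auto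
    finally have "card ?B \<le> card {Suc (nat \<lfloor>x\<rfloor>) - Y..nat \<lfloor>x\<rfloor>}" by (intro card_mono) auto
    then show False using assms by simp
  qed
  then obtain n where n: "n \<in> ?B" "\<not> (n \<le> nat \<lfloor>x\<rfloor> \<and> nat \<lfloor>x\<rfloor> < n + Y)" by auto
  then have "n + Y \<le> nat \<lfloor>x\<rfloor>" by (auto simp: le_nat_floor)
  moreover have "x \<ge> 0" using n by (auto intro: order_trans[of 0 "real n"])
  ultimately have nY: "real (n + Y) \<le> x"
    by (meson of_nat_floor of_nat_le_iff order_trans)
  let ?S = "{b - a | a b. 1 \<le> a \<and> a \<le> b \<and> real b \<le> x \<and> {a..b} \<inter> A = {}}"
  have "?S \<subseteq> {..nat \<lfloor>x\<rfloor>}" by (auto simp: le_nat_floor intro!: le_trans[OF diff_le_self])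
  then have "finite ?S" by (rule finite_subset) simp
  \<comment> \<open>In particular the set is nonempty, so the unspecified value of
    \<open>largest_gap\<close> does not arise.\<close>
  moreover have "Y \<in> ?S" using n nY by (intro CollectI exI[of _ n] exI[of _ "n + Y"]) auto
  ultimately show ?thesis unfolding largest_gap_def by (rule Max_ge)
qed

text \<open>For k \<le> K the powers of \<rho> are at most \<rho>^K, and the remaining sum of K^k /
  k! is at most exp(K). It turns error sums into K-th powers.\<close>

lemma sum_power_div_fact_le:
  fixes B \<rho> :: real
  assumes "0 \<le> B" "B \<le> real K * \<rho>" "\<rho> \<ge> 1"
  shows "(\<Sum>k\<le>K. B ^ k / fact k) \<le> (\<rho> * exp 1) ^ K"
proof -
  have "(\<Sum>k\<le>K. B ^ k / fact k) \<le> (\<Sum>k\<le>K. \<rho> ^ K * (real K ^ k / fact k))"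
  proof (rule sum_mono)
    fix k assume "k \<in> {..K}"
    have "B ^ k \<le> (real K * \<rho>) ^ k" using assms by (intro power_mono)
    also have "\<dots> = \<rho> ^ k * real K ^ k" by (simp add: power_mult_distrib)
    also have "\<dots> \<le> \<rho> ^ K * real K ^ k"
      using assms \<open>k \<in> {..K}\<close> by (intro mult_right_mono power_increasing) auto
    finally show "B ^ k / fact k \<le> \<rho> ^ K * (real K ^ k / fact k)"
      by (simp add: divide_right_mono)
  qed
  also have "\<dots> = \<rho> ^ K * (\<Sum>k\<le>K. real K ^ k / fact k)" by (simp only: sum_distrib_left)
  also have "\<dots> \<le> \<rho> ^ K * exp (real K)"
    using assms by (intro mult_left_mono sum_power_div_fact_le_exp) auto
  also have "\<dots> = (\<rho> * exp 1) ^ K" by (simp add: power_mult_distrib flip: exp_of_nat_mult)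
  finally show ?thesis .
qed

text \<open>The main term estimate needs ln t comparable to ln x. It supplies m from s on, and below
  s only a trivial bound B is available.\<close>

lemma integral_ge_split:
  fixes f :: "real \<Rightarrow> real"
  assumes "continuous_on {2..x} f" "2 \<le> s" "s \<le> x" "B \<ge> 0"
    and "\<And>t. 2 \<le> t \<Longrightarrow> t \<le> s \<Longrightarrow> f t \<ge> - B" and "\<And>t. s \<le> t \<Longrightarrow> t \<le> x \<Longrightarrow> f t \<ge> m"
  shows "integral {2..x} f \<ge> (x - s) * m - s * B"
proof -
  have int: "f integrable_on {2..x}" using assms(1) by (rule integrable_continuous_real)
  have int1: "f integrable_on {2..s}" and int2: "f integrable_on {s..x}"
    using assms by (auto intro: integrable_on_subinterval[OF int])
  have "integral {2..s} (\<lambda>_. - B) \<le> integral {2..s} f"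
    using assms int1 by (intro integral_le) auto
  moreover have "integral {s..x} (\<lambda>_. m) \<le> integral {s..x} f"
    using assms int2 by (intro integral_le) auto
  moreover have "integral {2..s} f + integral {s..x} f = integral {2..x} f"
    using assms int by (intro Henstock_Kurzweil_Integration.integral_combine) auto
  moreover have "(s - 2) * B \<le> s * B" using assms by (intro mult_right_mono) auto
  ultimately show ?thesis using assms by (simp add: algebra_simps)
qed

lemma sum_tuple_count_ge:
  fixes m :: real and E :: real
  defines "a \<equiv> \<lambda>Y k. \<Sum>H\<in>subsets_of_card {0..int Y} k. singular_series H"
  assumes Y: "Y \<ge> 2" and s: "2 \<le> s" "s \<le> x"
    and err: "\<And>H. H \<subseteq> {0..int Y} \<Longrightarrow> card H \<le> K \<Longrightarrow>
      \<bar>real (tuple_count A H x) - singular_series H * integral {2..x} (\<lambda>t. 1 / ln t ^ card H)\<bar> \<le> E"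
    and m: "\<And>t. s \<le> t \<Longrightarrow> t \<le> x \<Longrightarrow> (\<Sum>k\<le>K. (- 1) ^ k * a Y k / ln t ^ k) \<ge> m"
  shows "(\<Sum>k\<le>K. (- 1) ^ k * (\<Sum>H\<in>subsets_of_card {0..int Y} k. real (tuple_count A H x))) \<ge>
    (x - s) * m - s * (\<Sum>k\<le>K. (1144 * real (Y + 1)) ^ k / fact k)
      - E * (\<Sum>k\<le>K. real (Y + 1) ^ k / fact k)"
proof -
  let ?I = "{0..int Y}"
  define J where "J = (\<lambda>k. integral {2..x} (\<lambda>t. 1 / ln t ^ k))"
  \<comment> \<open>The hypothesis for the empty set bounds an absolute value by E.\<close>
  have "E \<ge> 0" using err[of "{}"] by (auto intro: order_trans[OF abs_ge_zero])
  have a0: "a Y k \<ge> 0" for k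
    unfolding a_def by (intro sum_nonneg) (auto intro: singular_series_nonneg)
  have cont: "continuous_on {2..x} (\<lambda>t. c / ln t ^ k)" for c :: real and k
    by (intro continuous_intros) auto
  have "integral {2..x} (\<lambda>t. \<Sum>k\<le>K. (- 1) ^ k * a Y k / ln t ^ k) =
      (\<Sum>k\<le>K. integral {2..x} (\<lambda>t. (- 1) ^ k * a Y k / ln t ^ k))"
    by (intro integral_sum integrable_continuous_real cont) auto
  also have "\<dots> = (\<Sum>k\<le>K. (- 1) ^ k * a Y k * J k)"
    unfolding J_def by (simp flip: integral_mult_right)
  finally have int: "integral {2..x} (\<lambda>t. \<Sum>k\<le>K. (- 1) ^ k * a Y k / ln t ^ k) = (\<Sum>k\<le>K. (- 1) ^ k * a Y k * J k)" .
  have "(x - s) * m - s * (\<Sum>k\<le>K. (1144 * real (Y + 1)) ^ k / fact k) \<le> (\<Sum>k\<le>K. (- 1) ^ k * a Y k * J k)"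
    unfolding int[symmetric]
  proof (rule integral_ge_split)
    show "continuous_on {2..x} (\<lambda>t. \<Sum>k\<le>K. (- 1) ^ k * a Y k / ln t ^ k)"
      by (intro continuous_intros cont) auto
    fix t :: real assume t: "2 \<le> t" "t \<le> s"
    \<comment> \<open>On the initial range 1 / ln t is at most 2, which doubles 572 to 1144.\<close>
    have "1 / 2 \<le> ln (2::real)" using ln2_ge_two_thirds by simp
    also have "\<dots> \<le> ln t" using t by simp
    finally have lnt: "1 / ln t \<le> 2" "ln t > 0" by (auto simp: field_simps)
    have "- (\<Sum>k\<le>K. (- 1) ^ k * a Y k / ln t ^ k) \<le> (\<Sum>k\<le>K. \<bar>(- 1) ^ k * a Y k / ln t ^ k\<bar>)"
      unfolding sum_negf[symmetric] by (intro sum_mono) (rule abs_ge_minus_self)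
    also have "\<dots> \<le> (\<Sum>k\<le>K. (1144 * real (Y + 1)) ^ k / fact k)"
    proof (rule sum_mono)
      fix k
      have "\<bar>(- 1) ^ k * a Y k / ln t ^ k\<bar> = a Y k * (1 / ln t) ^ k"
        using lnt a0[of k] by (simp add: abs_mult power_abs power_divide)
      also have "\<dots> \<le> (572 * real (Y + 1)) ^ k / fact k * 2 ^ k"
        unfolding a_def using lnt Y by (intro mult_mono sum_singular_series_le power_mono) auto
      also have "\<dots> = (1144 * real (Y + 1)) ^ k / fact k"
        by (simp flip: power_mult_distrib)
      finally show "\<bar>(- 1) ^ k * a Y k / ln t ^ k\<bar> \<le> (1144 * real (Y + 1)) ^ k / fact k" .
    qed
    finally show "- (\<Sum>k\<le>K. (1144 * real (Y + 1)) ^ k / fact k) \<le> (\<Sum>k\<le>K. (- 1) ^ k * a Y k / ln t ^ k)"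
      by linarith
  qed (use s m in \<open>auto intro!: sum_nonneg\<close>)
  moreover have "(\<Sum>k\<le>K. (- 1) ^ k * a Y k * J k)
      - (\<Sum>k\<le>K. (- 1) ^ k * (\<Sum>H\<in>subsets_of_card ?I k. real (tuple_count A H x))) \<le>
      (\<Sum>k\<le>K. E * (real (Y + 1) ^ k / fact k))"
    unfolding sum_subtractf[symmetric]
  proof (rule sum_mono)
    fix k assume k: "k \<in> {..K}"
    let ?D = "\<lambda>H. singular_series H * J k - real (tuple_count A H x)"
    have "(- 1) ^ k * a Y k * J k - (- 1) ^ k * (\<Sum>H\<in>subsets_of_card ?I k. real (tuple_count A H x)) =
        (- 1) ^ k * (\<Sum>H\<in>subsets_of_card ?I k. ?D H)"
      by (simp add: a_def sum_subtractf sum_distrib_right right_diff_distrib)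
    also have "\<dots> \<le> \<bar>\<Sum>H\<in>subsets_of_card ?I k. ?D H\<bar>"
      by (rule order_trans[OF abs_ge_self]) (simp add: abs_mult power_abs)
    also have "\<dots> \<le> (\<Sum>H\<in>subsets_of_card ?I k. \<bar>?D H\<bar>)" by (rule sum_abs)
    also have "\<dots> \<le> (\<Sum>H\<in>subsets_of_card ?I k. E)"
    proof (rule sum_mono)
      fix H assume "H \<in> subsets_of_card ?I k"
      then show "\<bar>?D H\<bar> \<le> E" using err[of H] k by (auto simp: J_def abs_minus_commute)
    qed
    also have "\<dots> = E * real ((Y + 1) choose k)" by (simp add: n_subsets nat_add_distrib)
    also have "\<dots> \<le> E * (real (Y + 1) ^ k / fact k)"
    proof -
      have "real ((Y + 1) choose k) * fact k \<le> real (Y + 1) ^ k"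
        using binomial_fact_pow[of "Y + 1" k]
        by (metis of_nat_fact of_nat_le_iff of_nat_mult of_nat_power)
      then show ?thesis using \<open>E \<ge> 0\<close> by (intro mult_left_mono) (simp_all add: pos_le_divide_eq)
    qed
    finally show "(- 1) ^ k * a Y k * J k - (- 1) ^ k * (\<Sum>H\<in>subsets_of_card ?I k. real (tuple_count A H x))
      \<le> E * (real (Y + 1) ^ k / fact k)" .
  qed
  ultimately show ?thesis unfolding sum_distrib_left[symmetric, of E] by linarith
qed


section \<open>Choice of parameters\<close>

lemma power_self_div_fact_le: "real K ^ K / fact K \<le> exp (real K)"
proof -
  have "real K ^ K / fact K \<le> (\<Sum>k\<le>K. real K ^ k / fact k)"
    by (intro member_le_sum) auto
  also have "\<dots> \<le> exp (real K)" by (intro sum_power_div_fact_le_exp) auto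
  finally show ?thesis .
qed

text \<open>Rounding down to an odd integer loses most for L just below 3, where K = 1; hence the
  factor 3.\<close>

lemma ex_odd_between:
  assumes "L \<ge> (1 :: real)"
  obtains K :: nat where "odd K" "real K \<le> L" "L \<le> 3 * real K"
proof (cases "odd (nat \<lfloor>L\<rfloor>)")
  case True
  then have "nat \<lfloor>L\<rfloor> \<ge> 1" by (cases "nat \<lfloor>L\<rfloor>") auto
  then have "L \<le> 3 * real (nat \<lfloor>L\<rfloor>)" "real (nat \<lfloor>L\<rfloor>) \<le> L" using assms by linarith+
  then show ?thesis using True that by blast
next
  case False
  have "nat \<lfloor>L\<rfloor> \<noteq> 0" "nat \<lfloor>L\<rfloor> \<noteq> 1" using assms False by auto
  then have ge: "nat \<lfloor>L\<rfloor> \<ge> 2" by linarith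
  then obtain n where n: "nat \<lfloor>L\<rfloor> = Suc n" "n \<ge> 1" by (cases "nat \<lfloor>L\<rfloor>") auto
  then have "odd n" using False by (simp only: even_Suc) simp
  moreover have "real n \<le> L" "L \<le> 3 * real n" using n assms by linarith+
  ultimately show ?thesis by (rule that)
qed

text \<open>As 51480 = 90 * 572, the quantity \<open>?\<mu>\<close> is at most K/90. The three terms
  of the bound become at least exp(-K), at most exp(-K) (e^2/90)^K \<le> exp(-K)/10, and at most
  exp(3 K)/z \<le> exp(-K)/4.\<close>

lemma main_term_ge_exp:
  fixes u :: real
  assumes Y: "Y \<ge> 2" "Y \<le> z" and K: "odd K" and z: "real z \<ge> 4 * exp (4 * real K)"
    and u: "u > 0" "1 / (sieve_density z * u) \<le> 1 / 2" and NK: "51480 * real (Y + 1) \<le> real K * u"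
  shows "(\<Sum>k\<le>K. (- 1) ^ k * (\<Sum>H\<in>subsets_of_card {0..int Y} k. singular_series H) / u ^ k) \<ge> exp (- real K) / 2"
proof -
  let ?\<mu> = "572 * real (Y + 1) / u"
  have K1: "K \<ge> 1" using K by (cases K) auto
  have \<mu>: "?\<mu> \<le> real K / 90" using NK u by (simp add: field_simps)
  have \<mu>0: "?\<mu> \<ge> 0" using u by simp
  have "K \<le> z"
  proof -
    have "real K \<le> 1 + 4 * real K" by simp
    also have "\<dots> \<le> exp (4 * real K)" by (rule exp_ge_add_one_self)
    also have "\<dots> \<le> real z" using z exp_gt_zero[of "4 * real K"] by linarith
    finally show ?thesis by simp
  qed
  have 1: "exp (- 2 * real (Y + 1) / u) \<ge> exp (- real K)"
  proof -
    have "2 * real (Y + 1) / u \<le> ?\<mu>" using u by (intro divide_right_mono) auto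
    then have "2 * real (Y + 1) / u \<le> real K" using \<mu> K1 by linarith
    then show ?thesis by (simp only: exp_le_cancel_iff mult_minus_left minus_divide_left[symmetric] neg_le_iff_le)
  qed
  have e3: "exp 1 \<le> (3::real)" by (rule exp_le)
  have 2: "?\<mu> ^ K / fact K \<le> exp (- real K) / 10"
  proof -
    have "?\<mu> ^ K / fact K \<le> (real K / 90) ^ K / fact K"
      using \<mu> \<mu>0 by (intro divide_right_mono power_mono) auto
    also have "\<dots> = (1 / 90) ^ K * (real K ^ K / fact K)" by (simp add: power_divide)
    also have "\<dots> \<le> (1 / 90) ^ K * exp (real K)"
      by (intro mult_left_mono power_self_div_fact_le) auto
    also have "\<dots> = exp (- real K) * ((1 / 90) ^ K * exp (real K) ^ 2)"
      by (simp add: power2_eq_square exp_minus field_simps)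
    also have "(1 / 90) ^ K * exp (real K) ^ 2 = (exp 1 ^ 2 / 90) ^ K"
      by (simp add: power_divide flip: exp_of_nat_mult power_mult)
    also have "\<dots> \<le> (1 / 10) ^ K"
    proof (rule power_mono)
      have "exp 1 ^ 2 \<le> (3::real) ^ 2" using e3 by (intro power_mono) auto
      then show "exp 1 ^ 2 / 90 \<le> (1 / 10 :: real)" by simp
    qed auto
    also have "\<dots> \<le> (1 / 10) ^ 1" using K1 by (intro power_decreasing) auto
    finally show ?thesis by simp
  qed
  have 3: "real K ^ 2 / real z * exp ?\<mu> \<le> exp (- real K) / 4"
  proof -
    have "real K \<le> exp (real K)" using exp_ge_add_one_self[of "real K"] by linarith
    moreover have "?\<mu> \<le> real K" using \<mu> by linarith
    then have "exp ?\<mu> \<le> exp (real K)" by (simp only: exp_le_cancel_iff)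
    ultimately have "real K ^ 2 * exp ?\<mu> \<le> exp (real K) ^ 2 * exp (real K)"
      by (intro mult_mono power_mono) auto
    also have "\<dots> = exp (- real K) * exp (4 * real K)"
      by (simp flip: exp_add exp_of_nat_mult)
    also have "\<dots> \<le> exp (- real K) * (real z / 4)" using z by (intro mult_left_mono) auto
    finally show ?thesis using z exp_gt_zero[of "4 * real K"]
      by (subst times_divide_eq_left, subst pos_divide_le_eq) (linarith, simp)
  qed
  show ?thesis
    using main_term_ge[OF Y K(1) \<open>K \<le> z\<close> u] 1 2 3 exp_gt_zero[of "- real K"] by linarith
qed

text \<open>Works at a single x. The numerical assumptions, \<open>E3\<close> to \<open>E7\<close>
  among them, collect everything that x must be large enough for.\<close>

lemma largest_gap_ge_of_tuple_count:
  fixes x \<kappa> C :: real and A :: "nat set"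
  defines "v \<equiv> ln x" and "w \<equiv> ln (ln x)"
  assumes \<kappa>: "2 * w / v \<le> \<kappa>" "\<kappa> \<le> 1 / 2"
    and err: "\<And>H :: int set. finite H \<Longrightarrow> \<forall>h\<in>H. 0 \<le> h \<and> real_of_int h \<le> v ^ 2 \<Longrightarrow>
      real (card H) \<le> \<kappa> * v / (2 * w) \<Longrightarrow>
      \<bar>real (tuple_count A H x) - singular_series H * integral {2..x} (\<lambda>t. 1 / ln t ^ card H)\<bar> \<le> C * x powr (1 - \<kappa>)"
    and x0: "x > 0" and v: "v \<ge> 2000000" and w: "w \<ge> 2" and E3: "4 * exp (v / w) \<ge> v ^ 2"
    and E4: "ln (5 * exp (v / w)) \<le> v / 88" and E5: "exp (v / 8) \<ge> 16"
    and E6: "exp (w - 1) \<ge> 16 * C" and E7: "exp (7 / 8 * v) / 8 > v ^ 2"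
  shows "real (largest_gap A x) \<ge> 1 / 1000000 * (\<kappa> * v ^ 2 / w)"
proof -
  define L where "L = \<kappa> * v / (2 * w)"
  have v0: "v > 0" "v \<ge> 1" and w0: "w > 0" using v w by linarith+
  have L1: "L \<ge> 1" using \<kappa>(1) v0 w0 unfolding L_def by (simp add: field_simps)
  \<comment> \<open>In other words (log x)^L = x^(\<kappa>/2), half of the saving in the
    hypothesis.\<close>
  have Lw: "w * L = \<kappa> * v / 2" using w0 by (simp add: L_def)
  have Lle: "4 * L \<le> v / w"
    using \<kappa>(2) v0 w0 by (simp add: L_def field_simps)
  have Lv: "L \<le> v / 8"
  proof -
    have "v / w \<le> v / 2" using w v0 by (intro divide_left_mono) auto
    then show ?thesis using Lle by linarith
  qed
  obtain K where K: "odd K" "real K \<le> L" "L \<le> 3 * real K" using ex_odd_between[OF L1] .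
  define y where "y = 1 / 1000000 * (\<kappa> * v ^ 2 / w)"
  have y: "y = 2 / 1000000 * (L * v)" by (simp add: y_def L_def power2_eq_square)
  define Y where "Y = nat \<lceil>y\<rceil>"
  have Lv2: "L * v \<ge> 2000000" using mult_mono[OF L1 v] v0 L1 by simp
  have y4: "y \<ge> 4" using Lv2 y by linarith
  have Yy: "real Y \<ge> y" "real Y < y + 1" using y4 unfolding Y_def by linarith+
  have Y2: "Y \<ge> 2" using Yy y4 by linarith
  have N: "real (Y + 1) \<le> 3 / 1000000 * (L * v)" using Yy y Lv2 by simp
  define T where "T = real K * v"
  have NK: "real (Y + 1) \<le> 9 / 1000000 * T"
  proof -
    have "L * v \<le> 3 * real K * v" using K(3) v0(1) by (intro mult_right_mono) auto
    then have "L * v \<le> 3 * T" by (simp only: T_def mult.assoc)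
    then show ?thesis using N by linarith
  qed
  have "T \<ge> 0" using v0 by (simp add: T_def)
  \<comment> \<open>Here the constant 1/1000000 is tested: 51480 * 9/1000000 < 1/2 for the main
    term, 1144 * 9/1000000 < 1/3 for the error sums.\<close>
  then have NT: "51480 * n \<le> T / 2" "1144 * n \<le> T / 3" if "n \<le> 9 / 1000000 * T" for n
    using that by linarith+
  have Nv: "real (Y + 1) \<le> v ^ 2"
  proof -
    have "L * v \<le> v / 8 * v" using Lv v0 by (intro mult_right_mono) auto
    then show ?thesis using N Lv2 by (simp add: power2_eq_square)
  qed
  have x: "x = exp v" using x0 by (simp add: v_def)
  \<comment> \<open>The square root of x: from s on ln t \<ge> v/2, while the range below s is
    negligible.\<close>
  define s where "s = exp (v / 2)"
  have ss: "s * s = x" by (simp add: s_def x flip: exp_add)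
  have s2: "s \<ge> 2" using exp_ge_add_one_self[of "v / 2"] v unfolding s_def by linarith
  have sx: "s \<le> x / 2" using mult_right_mono[OF s2, of s] s2 ss by simp
  \<comment> \<open>Large enough for 4 exp(4 K) because 4 K \<le> v/w. Small enough for ln z \<le>
    v/88, hence 1/\<Theta> \<le> v/4 and q \<le> (v/4) / (v/2) = 1/2.\<close>
  define z where "z = nat \<lceil>4 * exp (v / w)\<rceil>"
  have z: "real z \<ge> 4 * exp (v / w)" "real z \<le> 4 * exp (v / w) + 1"
    using exp_gt_zero[of "v / w"] unfolding z_def by linarith+
  have Yz: "Y \<le> z" using Nv E3 z by linarith
  have expK: "exp (4 * real K) \<le> exp (v / w)" using K Lle by simp
  have exp1: "exp (v / w) \<ge> 1" using v0 w0 by simp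
  have dens: "1 / sieve_density z \<le> v / 4"
  proof -
    have "1 / sieve_density z \<le> 22 * ln (real z)"
      using Yz Y2 by (intro sieve_density_inverse_le) auto
    also have "ln (real z) \<le> ln (5 * exp (v / w))"
      using z exp1 by (intro ln_mono) linarith+
    finally show ?thesis using E4 by linarith
  qed
  have main: "(\<Sum>k\<le>K. (- 1) ^ k * (\<Sum>H\<in>subsets_of_card {0..int Y} k. singular_series H) / ln t ^ k) \<ge> exp (- real K) / 2"
    if t: "s \<le> t" "t \<le> x" for t
  proof -
    have "ln s \<le> ln t" using t s2 by (intro ln_mono) auto
    then have lnt: "ln t \<ge> v / 2" by (simp add: s_def)
    show ?thesis
    proof (rule main_term_ge_exp[OF Y2 Yz K(1)])
      show "real z \<ge> 4 * exp (4 * real K)" using z expK by linarith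
      show lnt0: "ln t > 0" using lnt v0 by linarith
      have "1 / (sieve_density z * ln t) = 1 / sieve_density z / ln t" by simp
      also have "\<dots> \<le> v / 4 / (v / 2)"
        using v0 by (intro frac_le[OF _ dens _ lnt]) auto
      also have "\<dots> = 1 / 2" using v0 by simp
      finally show "1 / (sieve_density z * ln t) \<le> 1 / 2" .
      have "51480 * real (Y + 1) \<le> T / 2" by (rule NT(1)[OF NK])
      also have "\<dots> = real K * (v / 2)" by (simp add: T_def)
      also have "\<dots> \<le> real K * ln t" using lnt by (intro mult_left_mono) auto
      finally show "51480 * real (Y + 1) \<le> real K * ln t" .
    qed
  qed
  define E where "E = C * x powr (1 - \<kappa>)"
  have xp: "x powr (1 - \<kappa>) = exp (v - \<kappa> * v)"
    by (simp add: x powr_def algebra_simps)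
  have E0: "E \<ge> 0" using err[of "{}"] L1 by (auto simp: E_def L_def intro: order_trans[OF abs_ge_zero])
  have count: "real (card {n::nat. 1 \<le> n \<and> real n \<le> x \<and> {n..n + Y} \<inter> A = {}}) \<ge>
    (x - s) * (exp (- real K) / 2) - s * (\<Sum>k\<le>K. (1144 * real (Y + 1)) ^ k / fact k)
      - E * (\<Sum>k\<le>K. real (Y + 1) ^ k / fact k)"
  proof (rule order_trans[OF sum_tuple_count_ge[OF Y2 s2 _ _ main] sum_tuple_count_le[OF K(1)]])
    show "s \<le> x" using sx x0 by linarith
    fix H assume H: "H \<subseteq> {0..int Y}" "card H \<le> K"
    show "\<bar>real (tuple_count A H x) - singular_series H * integral {2..x} (\<lambda>t. 1 / ln t ^ card H)\<bar> \<le> E"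
      unfolding E_def
    proof (rule err)
      show "finite H" using H by (auto intro: finite_subset)
      have "real_of_int h \<le> v ^ 2" if "h \<le> int Y" for h
        using that Nv by linarith
      then show "\<forall>h\<in>H. 0 \<le> h \<and> real_of_int h \<le> v ^ 2" using H by auto
      show "real (card H) \<le> \<kappa> * v / (2 * w)" using H K L_def by linarith
    qed
  qed auto
  \<comment> \<open>The 1/3 in B \<le> K v/3 absorbs the factor e, leaving exactly v^K \<le>
    x^(\<kappa>/2).\<close>
  have powsum: "(\<Sum>k\<le>K. B ^ k / fact k) \<le> exp (\<kappa> * v / 2)" if "0 \<le> B" "B \<le> 1144 * real (Y + 1)" for B
  proof -
    have "B \<le> T / 3" using that(2) NT(2)[OF NK] by (rule order_trans)
    then have "B \<le> real K * (v / 3)" by (simp add: T_def)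
    then have "(\<Sum>k\<le>K. B ^ k / fact k) \<le> (v / 3 * exp 1) ^ K"
      using that v by (intro sum_power_div_fact_le) auto
    also have "\<dots> \<le> v ^ K" using exp_le v0 by (intro power_mono) auto
    also have "\<dots> = exp (w * real K)"
      using v0 by (simp add: w_def v_def[symmetric] mult.commute exp_of_nat_mult)
    also have "\<dots> \<le> exp (\<kappa> * v / 2)"
      using mult_left_mono[OF K(2), of w] w0 Lw by simp
    finally show ?thesis .
  qed
  let ?M = "exp (v - real K)"
  have M: "x * exp (- real K) = ?M" by (simp add: x flip: exp_add)
  have T1: "?M / 4 \<le> (x - s) * (exp (- real K) / 2)"
    using mult_right_mono[of "x / 2" "x - s" "exp (- real K) / 2"] sx unfolding M[symmetric] by simp
  \<comment> \<open>At most x^(1/2 + \<kappa>/2) \<le> x^(3/4), whereas \<open>?M\<close> is at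
    least x^(7/8).\<close>
  have T2: "s * (\<Sum>k\<le>K. (1144 * real (Y + 1)) ^ k / fact k) \<le> ?M / 16"
  proof -
    have "s * (\<Sum>k\<le>K. (1144 * real (Y + 1)) ^ k / fact k) \<le> s * exp (\<kappa> * v / 2)"
      using s2 by (intro mult_left_mono powsum) auto
    also have "\<dots> = exp (v / 2 + \<kappa> * v / 2)" by (simp add: s_def exp_add)
    also have "\<dots> \<le> exp (v - real K - v / 8)"
    proof -
      have "\<kappa> * v \<le> 1 / 2 * v" using \<kappa>(2) v0 by (intro mult_right_mono) auto
      then have "v / 2 + \<kappa> * v / 2 \<le> v - real K - v / 8" using K(2) Lv by linarith
      then show ?thesis by simp
    qed
    also have "\<dots> = ?M / exp (v / 8)" by (rule exp_diff)
    also have "\<dots> \<le> ?M / 16" using E5 by (intro divide_left_mono) auto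
    finally show ?thesis .
  qed
  \<comment> \<open>The total is C x^(1 - \<kappa>/2) = C exp(v - w L), smaller than
    \<open>?M\<close> by a factor of at least exp((w - 1) L) / C, so at least exp(w - 1) / C. This
    growth absorbs any C.\<close>
  have T3: "E * (\<Sum>k\<le>K. real (Y + 1) ^ k / fact k) \<le> ?M / 16"
  proof -
    have C0: "C \<ge> 0" using E0 xp by (simp add: E_def zero_le_mult_iff)
    have "E * (\<Sum>k\<le>K. real (Y + 1) ^ k / fact k) \<le> E * exp (\<kappa> * v / 2)"
      using E0 by (intro mult_left_mono powsum) auto
    also have "\<dots> = C * exp (v - w * L)"
      unfolding E_def xp Lw by (simp add: mult.assoc flip: exp_add)
    also have "\<dots> \<le> C * exp (v - real K - (w - 1))"
    proof -
      have "(w - 1) * 1 \<le> (w - 1) * L" using w L1 by (intro mult_left_mono) auto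
      then have "v - w * L \<le> v - real K - (w - 1)" using K(2) by (simp add: algebra_simps)
      then show ?thesis using C0 by (intro mult_left_mono) auto
    qed
    also have "\<dots> = ?M * (C / exp (w - 1))" by (simp add: exp_diff[of "v - real K"])
    also have "\<dots> \<le> ?M * (1 / 16)"
      using E6 by (intro mult_left_mono) (auto simp: pos_divide_le_eq)
    finally show ?thesis by simp
  qed
  \<comment> \<open>What remains of \<open>?M / 4\<close> after two errors of
    \<open>?M / 16\<close>.\<close>
  have "?M / 8 > real Y"
  proof -
    have "exp (7 / 8 * v) \<le> ?M" using K(2) Lv by simp
    then show ?thesis using E7 Nv by linarith
  qed
  then have "real (card {n::nat. 1 \<le> n \<and> real n \<le> x \<and> {n..n + Y} \<inter> A = {}}) > real Y"
    using count T1 T2 T3 by linarith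
  then have "largest_gap A x \<ge> Y" by (rule largest_gap_ge)
  then show ?thesis using Yy(1) unfolding y_def by linarith
qed

theorem theorem1p5:
  "\<exists>c\<^sub>0::real. c\<^sub>0 > 0 \<and>
     (\<forall>(\<kappa> :: real \<Rightarrow> real) (A :: nat set).
        (\<forall>\<^sub>F x in at_top. 2 * ln (ln x) / ln x \<le> \<kappa> x \<and> \<kappa> x \<le> 1 / 2) \<longrightarrow>
        (\<exists>C::real. \<forall>\<^sub>F x in at_top. \<forall>H :: int set.
            finite H \<longrightarrow>
            (\<forall>h\<in>H. 0 \<le> h \<and> real_of_int h \<le> (ln x)\<^sup>2) \<longrightarrow>
            real (card H) \<le> \<kappa> x * ln x / (2 * ln (ln x)) \<longrightarrow>
            \<bar>real (tuple_count A H x)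
               - singular_series H * integral {2..x} (\<lambda>t. 1 / ln t ^ card H)\<bar>
              \<le> C * x powr (1 - \<kappa> x)) \<longrightarrow>
        (\<forall>\<^sub>F x in at_top.
            real (largest_gap A x) \<ge> c\<^sub>0 * (\<kappa> x * (ln x)\<^sup>2 / ln (ln x))))"
proof (intro exI[of _ "1 / 1000000"] conjI allI impI)
  fix \<kappa> :: "real \<Rightarrow> real" and A :: "nat set"
  assume \<kappa>: "\<forall>\<^sub>F x in at_top. 2 * ln (ln x) / ln x \<le> \<kappa> x \<and> \<kappa> x \<le> 1 / 2"
  assume "\<exists>C::real. \<forall>\<^sub>F x in at_top. \<forall>H :: int set.
            finite H \<longrightarrow>
            (\<forall>h\<in>H. 0 \<le> h \<and> real_of_int h \<le> (ln x)\<^sup>2) \<longrightarrow>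
            real (card H) \<le> \<kappa> x * ln x / (2 * ln (ln x)) \<longrightarrow>
            \<bar>real (tuple_count A H x)
               - singular_series H * integral {2..x} (\<lambda>t. 1 / ln t ^ card H)\<bar>
              \<le> C * x powr (1 - \<kappa> x)"
  then obtain C where err: "\<forall>\<^sub>F x in at_top. \<forall>H :: int set.
            finite H \<longrightarrow>
            (\<forall>h\<in>H. 0 \<le> h \<and> real_of_int h \<le> (ln x)\<^sup>2) \<longrightarrow>
            real (card H) \<le> \<kappa> x * ln x / (2 * ln (ln x)) \<longrightarrow>
            \<bar>real (tuple_count A H x)
               - singular_series H * integral {2..x} (\<lambda>t. 1 / ln t ^ card H)\<bar>
              \<le> C * x powr (1 - \<kappa> x)" by blast
  have "\<forall>\<^sub>F x in at_top. ln x \<ge> (2000000::real)" by real_asymp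
  moreover have "\<forall>\<^sub>F x in at_top. ln (ln x) \<ge> (2::real)" by real_asymp
  moreover have "\<forall>\<^sub>F x in at_top. 4 * exp (ln x / ln (ln x)) \<ge> (ln x :: real) ^ 2" by real_asymp
  moreover have "\<forall>\<^sub>F x in at_top. ln (5 * exp (ln x / ln (ln x))) \<le> (ln x :: real) / 88" by real_asymp
  moreover have "\<forall>\<^sub>F x in at_top. exp (ln x / 8) \<ge> (16::real)" by real_asymp
  moreover have "filterlim (\<lambda>x::real. exp (ln (ln x) - 1)) at_top at_top" by real_asymp
  then have "\<forall>\<^sub>F x in at_top. exp (ln (ln x) - 1) \<ge> 16 * C" by (simp add: filterlim_at_top)
  moreover have "\<forall>\<^sub>F x in at_top. exp (7 / 8 * ln x) / 8 > (ln x :: real) ^ 2" by real_asymp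
  moreover have "\<forall>\<^sub>F x in at_top. x > (0::real)" by (rule eventually_gt_at_top)
  ultimately show "\<forall>\<^sub>F x in at_top. real (largest_gap A x) \<ge> 1 / 1000000 * (\<kappa> x * (ln x)\<^sup>2 / ln (ln x))"
    using \<kappa> err
  proof eventually_elim
    case (elim x)
    show ?case by (rule largest_gap_ge_of_tuple_count[of x "\<kappa> x" A C]) (use elim in blast)+
  qed
qed simp

end
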